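(* For the two-dimensional Randers metric function $F=S+b$, built from a Riemannian metric $a_{ij}(x)$ and a one-form $b=b_i(x)y^i$ of norm $c(x)\in(0,1)$, the partial derivatives $\partial F/\partial x^n$ and $\partial\theta/\partial x^n$, where $\theta=\theta(x,y)$ is the angle function, are of class $C^\infty$ with respect to $y$ globally on $T_xM\setminus\{0\}$. Consequently the coefficients $$N^k_n=-l^k\,\frac{\partial F}{\partial x^n}-F\,m^k\left(\frac{\partial\theta}{\partial x^n}-k_n\right),$$ with $k_n=k_n(x)$ a covariant vector field, yield an angle-preserving connection of $C^\infty$-regular status globally regarding the $y$-dependence.
   Context: $M$ is a 2-dimensional $C^\infty$ manifold (local coordinates $x^i$, tangent vectors $y=(y^i)\in T_xM$) with a Riemannian metric tensor $a_{ij}(x)$ and two covector fields $\tilde b_i(x),n_i(x)$ orthonormal with respect to $a_{ij}$; $c(x)$ with $0<c<1$ is a scalar. The dependence on $x$ is smooth. Put $b_i=c\,\tilde b_i$, $b^i=a^{ij}b_j$ with $a^{ij}$ the inverse of $a_{ij}$, $b=b_iy^i$, $n=n_iy^i$, $S=\sqrt{a_{ij}y^iy^j}$, $F=S+b$, $l^k=y^k/F$, $g_{ij}=\frac12\partial^2F^2/\partial y^i\partial y^j$, $g^{ij}$ its inverse, $y_k=g_{kj}y^j$, $m_i=\frac1{cS}\sqrt{\frac FS}\,(bn_i-nb_i)$, $m^i=g^{ij}m_j$. The angle function $\theta=\theta(x,y)$ is a single function on $T_xM\setminus\{0\}$, positively homogeneous of degree zero in $y$, defined by $F\,\partial\theta/\partial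 y^i=m_i$ and $\theta(x,b(x))=0$, where $b(x)=(b^i(x))$; it measures the length of arc along the indicatrix $\{F=1\}$. It is described by means of the atlas of $T_xM\setminus\{0\}$ consisting of the four charts $\{b>0\}$, $\{n>0\}$, $\{n<0\}$, $\{b<0\}$. Angle-preserving connection: with $d_n=\partial/\partial x^n+N^k_n\,\partial/\partial y^k$, the coefficients $N^k_n$ above satisfy $d_nF=0$, $d_n\theta=k_n$ and $y_k\,\partial^2N^k_n/\partial y^m\partial y^i=0$; hence $d_n(\theta(x,y_2)-\theta(x,y_1))=0$ for pairs of tangent vectors $y_1,y_2\in T_xM$ (with $d_n$ acting on both arguments). The connection consists of $N^k_n$ and $D^k{}_{nm}=-\partial N^k_n/\partial y^m$.
   Formalization: No single-valued θ exists on all of T_xM∖{0} (its differential has a positive period around 0), so θ and the connection are taken on open conic domains with connected fibres containing b(x); θ is shown to exist on the union of any three charts including {b>0}. *)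

theory Defs
  imports "HOL-Analysis.Analysis"
begin

text \<open>Everything is written in one coordinate neighbourhood \<open>U\<close> of the surface \<open>M\<close>: a point is
  \<open>x :: real^2\<close>, a tangent vector is its component vector \<open>y :: real^2\<close>, and all index
  expressions are component expressions in these coordinates.\<close>

section \<open>Smoothness and partial derivatives\<close>

text \<open>\<open>smooth_on S f\<close> is \<open>C\<^sup>\<infinity>\<close> on an open set \<open>S\<close>.\<close>

fun diff_times_on ::
  "nat \<Rightarrow> 'a::real_normed_vector set \<Rightarrow> ('a \<Rightarrow> 'b::real_normed_vector) \<Rightarrow> bool" where
  "diff_times_on 0 S f \<longleftrightarrow> continuous_on S f"
| "diff_times_on (Suc k) S f \<longleftrightarrow>
     (\<forall>x\<in>S. f differentiable (at x)) \<and>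
     (\<forall>v. diff_times_on k S (\<lambda>x. frechet_derivative f (at x) v))"

definition smooth_on ::
  "'a::real_normed_vector set \<Rightarrow> ('a \<Rightarrow> 'b::real_normed_vector) \<Rightarrow> bool" where
  "smooth_on S f \<longleftrightarrow> (\<forall>k. diff_times_on k S f)"

definition partial :: "'n::finite \<Rightarrow> (real^'n \<Rightarrow> real) \<Rightarrow> real^'n \<Rightarrow> real" where
  "partial i f x = deriv (\<lambda>t. f (x + t *\<^sub>R axis i 1)) 0"

section \<open>The two-dimensional Randers metric\<close>

record randers =
  metric :: "real^2 \<Rightarrow> real^2^2"   \<comment> \<open>\<open>a\<^sub>i\<^sub>j(x)\<close>\<close>
  covb   :: "real^2 \<Rightarrow> real^2"     \<comment> \<open>the unit covector field (b tilde)\<close>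
  covn   :: "real^2 \<Rightarrow> real^2"     \<comment> \<open>\<open>n\<^sub>i(x)\<close>\<close>
  bnorm  :: "real^2 \<Rightarrow> real"       \<comment> \<open>\<open>c(x)\<close>\<close>

definition ainv :: "randers \<Rightarrow> real^2 \<Rightarrow> real^2^2" where
  "ainv R x = matrix_inv (metric R x)"

definition randers_on :: "(real^2) set \<Rightarrow> randers \<Rightarrow> bool" where
  "randers_on U R \<longleftrightarrow>
     open U \<and>
     smooth_on U (metric R) \<and> smooth_on U (covb R) \<and>
     smooth_on U (covn R) \<and> smooth_on U (bnorm R) \<and>
     (\<forall>x\<in>U.
        transpose (metric R x) = metric R x \<and>
        (\<forall>y. y \<noteq> 0 \<longrightarrow> y \<bullet> (metric R x *v y) > 0) \<and>
        covb R x \<bullet> (ainv R x *v covb R x) = 1 \<and>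
        covn R x \<bullet> (ainv R x *v covn R x) = 1 \<and>
        covb R x \<bullet> (ainv R x *v covn R x) = 0 \<and>
        0 < bnorm R x \<and> bnorm R x < 1)"

definition b_low :: "randers \<Rightarrow> real^2 \<Rightarrow> real^2" where
  "b_low R x = bnorm R x *\<^sub>R covb R x"

definition b_up :: "randers \<Rightarrow> real^2 \<Rightarrow> real^2" where
  "b_up R x = ainv R x *v b_low R x"

definition b_form :: "randers \<Rightarrow> real^2 \<Rightarrow> real^2 \<Rightarrow> real" where
  "b_form R x y = b_low R x \<bullet> y"

definition n_form :: "randers \<Rightarrow> real^2 \<Rightarrow> real^2 \<Rightarrow> real" where
  "n_form R x y = covn R x \<bullet> y"

definition SS :: "randers \<Rightarrow> real^2 \<Rightarrow> real^2 \<Rightarrow> real" where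
  "SS R x y = sqrt (y \<bullet> (metric R x *v y))"

definition FF :: "randers \<Rightarrow> real^2 \<Rightarrow> real^2 \<Rightarrow> real" where
  "FF R x y = SS R x y + b_form R x y"

definition l_up :: "randers \<Rightarrow> real^2 \<Rightarrow> real^2 \<Rightarrow> real^2" where
  "l_up R x y = (1 / FF R x y) *\<^sub>R y"

definition gg :: "randers \<Rightarrow> real^2 \<Rightarrow> real^2 \<Rightarrow> real^2^2" where
  "gg R x y = (\<chi> i j. 1/2 * partial i (partial j (\<lambda>z. (FF R x z)\<^sup>2)) y)"

definition y_low :: "randers \<Rightarrow> real^2 \<Rightarrow> real^2 \<Rightarrow> real^2" where
  "y_low R x y = gg R x y *v y"

definition m_low :: "randers \<Rightarrow> real^2 \<Rightarrow> real^2 \<Rightarrow> real^2" where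
  "m_low R x y = (1 / (bnorm R x * SS R x y) * sqrt (FF R x y / SS R x y)) *\<^sub>R
     (b_form R x y *\<^sub>R covn R x - n_form R x y *\<^sub>R b_low R x)"

definition m_up :: "randers \<Rightarrow> real^2 \<Rightarrow> real^2 \<Rightarrow> real^2" where
  "m_up R x y = matrix_inv (gg R x y) *v m_low R x y"

section \<open>The angle function\<close>

definition punctured_TM :: "(real^2) set \<Rightarrow> ((real^2) \<times> (real^2)) set" where
  "punctured_TM U = U \<times> (- {0})"

datatype chart = B_pos | N_pos | N_neg | B_neg

fun chart_dom :: "(real^2) set \<Rightarrow> randers \<Rightarrow> chart \<Rightarrow> ((real^2) \<times> (real^2)) set" where
  "chart_dom U R B_pos = {(x, y). x \<in> U \<and> b_form R x y > 0}"
| "chart_dom U R N_pos = {(x, y). x \<in> U \<and> n_form R x y > 0}"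
| "chart_dom U R N_neg = {(x, y). x \<in> U \<and> n_form R x y < 0}"
| "chart_dom U R B_neg = {(x, y). x \<in> U \<and> b_form R x y < 0}"

definition fib :: "((real^2) \<times> (real^2)) set \<Rightarrow> real^2 \<Rightarrow> (real^2) set" where
  "fib W x = {y. (x, y) \<in> W}"

text \<open>Going once around the origin of \<open>T\<^sub>xM\<close>, the form \<open>(m\<^sub>i / F) dy\<^sup>i\<close> integrates to the
  total length of the indicatrix, which is positive and depends on \<open>c(x)\<close>.  So the conditions
  defining the angle function are met by no single-valued function on all of
  \<open>T\<^sub>xM - {0}\<close>; they are therefore stated on a domain \<open>W\<close>.  The choice
  \<open>W = punctured_TM U\<close> would be the single-valued global case; single-valued angle functions
  exist as soon as one of the charts other than \<open>{b > 0}\<close> is left out.  Since the fibres of \<open>W\<close>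
  are connected and contain \<open>b(x)\<close>, the angle function on \<open>W\<close> is uniquely determined.\<close>

definition angle_function ::
  "(real^2) set \<Rightarrow> randers \<Rightarrow> ((real^2) \<times> (real^2)) set \<Rightarrow> (real^2 \<Rightarrow> real^2 \<Rightarrow> real) \<Rightarrow> bool" where
  "angle_function U R W \<theta> \<longleftrightarrow>
     open W \<and> W \<subseteq> punctured_TM U \<and>
     (\<forall>x\<in>U. connected (fib W x) \<and> b_up R x \<in> fib W x) \<and>
     (\<forall>x y t. (x, y) \<in> W \<longrightarrow> t > 0 \<longrightarrow> (x, t *\<^sub>R y) \<in> W \<and> \<theta> x (t *\<^sub>R y) = \<theta> x y) \<and>
     (\<forall>x y. (x, y) \<in> W \<longrightarrow>
        \<theta> x differentiable (at y) \<and>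
        (\<forall>i. FF R x y * partial i (\<theta> x) y = m_low R x y $ i)) \<and>
     (\<forall>x\<in>U. \<theta> x (b_up R x) = 0)"

section \<open>The connection\<close>

text \<open>The coefficient \<open>N\<^sup>k\<^sub>n(x,y)\<close> is \<open>N k n x y\<close>, and \<open>D\<^sup>k\<^sub>n\<^sub>m(x,y)\<close> is \<open>D k n m x y\<close>.\<close>

type_synonym coeffs = "2 \<Rightarrow> 2 \<Rightarrow> real^2 \<Rightarrow> real^2 \<Rightarrow> real"

definition N_coeff ::
  "randers \<Rightarrow> (real^2 \<Rightarrow> real^2 \<Rightarrow> real) \<Rightarrow> (real^2 \<Rightarrow> real^2) \<Rightarrow> coeffs" where
  "N_coeff R \<theta> kf k n x y =
     - (l_up R x y $ k) * partial n (\<lambda>u. FF R u y) x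
     - FF R x y * m_up R x y $ k * (partial n (\<lambda>u. \<theta> u y) x - kf x $ n)"

definition D_coeff :: "coeffs \<Rightarrow> 2 \<Rightarrow> 2 \<Rightarrow> 2 \<Rightarrow> real^2 \<Rightarrow> real^2 \<Rightarrow> real" where
  "D_coeff N k n m x y = - partial m (N k n x) y"

definition d_op :: "coeffs \<Rightarrow> 2 \<Rightarrow> (real^2 \<Rightarrow> real^2 \<Rightarrow> real) \<Rightarrow> real^2 \<Rightarrow> real^2 \<Rightarrow> real" where
  "d_op N n f x y = partial n (\<lambda>u. f u y) x + (\<Sum>k\<in>UNIV. N k n x y * partial k (f x) y)"

text \<open>The action of \<open>d\<^sub>n\<close> on functions of a point and two tangent vectors.\<close>

definition d_op2 ::
  "coeffs \<Rightarrow> 2 \<Rightarrow> (real^2 \<Rightarrow> real^2 \<Rightarrow> real^2 \<Rightarrow> real) \<Rightarrow> real^2 \<Rightarrow> real^2 \<Rightarrow> real^2 \<Rightarrow> real" where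
  "d_op2 N n h x y1 y2 =
     partial n (\<lambda>u. h u y1 y2) x
     + (\<Sum>k\<in>UNIV. N k n x y1 * partial k (\<lambda>z. h x z y2) y1)
     + (\<Sum>k\<in>UNIV. N k n x y2 * partial k (\<lambda>z. h x y1 z) y2)"

definition angle_preserving ::
  "randers \<Rightarrow> ((real^2) \<times> (real^2)) set \<Rightarrow> (real^2 \<Rightarrow> real^2 \<Rightarrow> real) \<Rightarrow> (real^2 \<Rightarrow> real^2) \<Rightarrow> coeffs \<Rightarrow> bool"
where
  "angle_preserving R W \<theta> kf N \<longleftrightarrow>
     (\<forall>x y n. (x, y) \<in> W \<longrightarrow>
        d_op N n (FF R) x y = 0 \<and>
        d_op N n \<theta> x y = kf x $ n \<and>
        (\<forall>m i. (\<Sum>k\<in>UNIV. y_low R x y $ k * partial m (partial i (N k n x)) y) = 0)) \<and>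
     (\<forall>x y1 y2 n. (x, y1) \<in> W \<longrightarrow> (x, y2) \<in> W \<longrightarrow>
        d_op2 N n (\<lambda>u z1 z2. \<theta> u z2 - \<theta> u z1) x y1 y2 = 0)"

end

theory Submission
  imports Defs
begin

text \<open>Write \<open>p\<close> and \<open>q\<close> for the two coframe components of \<open>y\<close>, so that \<open>S = \<surd>(p\<^sup>2 + q\<^sup>2)\<close> and
  \<open>F = S + c p\<close>.  Then \<open>m\<^sub>i / F\<close> is \<open>\<surd>(S/F) (p dq - q dp) / S\<^sup>2\<close>, that is, \<open>d\<psi> / \<surd>(1 + c cos \<psi>)\<close> in
  terms of the polar angle \<open>\<psi>\<close> of \<open>(p, q)\<close>.  Hence every angle function is, near each of its points,
  an incomplete elliptic integral \<open>G(c(x), \<psi>(x, y))\<close> for a smooth branch of \<open>\<psi>\<close>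
  (\<open>angle_function_local_form\<close>).  The definition of an angle function controls only its differential
  along the fibres; the dependence on \<open>x\<close> is recovered by starting at \<open>b(x)\<close>, where the value is
  known, and spreading the formula through the connected fibre: branches differ by multiples of
  \<open>2\<pi>\<close>, so they cannot jump when \<open>x\<close> moves a little.

  Differentiating the formula in \<open>x\<close> gives \<open>\<partial>\<theta>/\<partial>x\<^sup>n\<close> as \<open>(\<partial>c/\<partial>x\<^sup>n) (\<partial>G/\<partial>c)\<close> plus an algebraic
  expression in \<open>p\<close>, \<open>q\<close>, \<open>S\<close>.  The first term is not elementary, but its differential in \<open>y\<close> is again
  algebraic in \<open>p\<close>, \<open>q\<close>, \<open>S\<close>, with no denominators other than powers of \<open>S\<close> and \<open>F\<close>; so \<open>\<partial>\<theta>/\<partial>x\<^sup>n\<close> is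
  smooth in \<open>y\<close> away from the origin (\<open>theta_base_derivative_smooth\<close>), and the coefficients \<open>N\<close>
  inherit this (\<open>N_coeff_smooth\<close>).

  The vectors \<open>l\<close>, \<open>m\<^sup>i\<close> form the frame dual to \<open>F\<^sub>i\<close>, \<open>m\<^sub>i\<close>, which makes \<open>d\<^sub>n F = 0\<close> and
  \<open>d\<^sub>n \<theta> = k\<^sub>n\<close> immediate.  For the remaining condition, the variation of the coframe contributes to
  \<open>N\<close> only a term linear in \<open>y\<close>, and the rest has the form \<open>S V(\<psi>)\<close>.  The Hessian of such a function is
  a multiple of \<open>V + V''\<close>, and \<open>F\<^sub>k (V + V'')\<^sup>k = 0\<close> is an ordinary differential identity in one variable
  (\<open>profile_contraction\<close>, \<open>N_coeff_contraction\<close>).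

  Finally, leaving out one of the charts other than \<open>{b > 0}\<close> cuts every fibre along a ray that avoids
  \<open>b(x)\<close>, and there a single branch of \<open>\<psi>\<close> defines an angle function (\<open>angle_function_slit\<close>).\<close>

section \<open>Closure properties of smooth functions\<close>

lemma diff_times_on_cong:
  fixes f g :: "'a::real_normed_vector \<Rightarrow> 'b::real_normed_vector"
  assumes "open S"
  shows "(\<And>x. x \<in> S \<Longrightarrow> f x = g x) \<Longrightarrow> diff_times_on k S f \<Longrightarrow> diff_times_on k S g"
proof (induction k arbitrary: f g)
  case 0
  then show ?case by (simp cong: continuous_on_cong)
next
  case (Suc k)
  have d: "(g has_derivative frechet_derivative f (at x)) (at x)" if "x \<in> S" for x
    using Suc.prems that assms
    by (auto simp: frechet_derivative_works intro: has_derivative_transform_within_open)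
  moreover have "frechet_derivative f (at x) = frechet_derivative g (at x)" if "x \<in> S" for x
    using frechet_derivative_at[OF d[OF that]] .
  ultimately show ?case
    using Suc.prems Suc.IH[of "\<lambda>x. frechet_derivative f (at x) v" "\<lambda>x. frechet_derivative g (at x) v" for v]
    by (auto simp: differentiable_def)
qed

lemma diff_times_on_SucI:
  fixes f :: "'a::real_normed_vector \<Rightarrow> 'b::real_normed_vector"
  assumes "open S" and d: "\<And>x. x \<in> S \<Longrightarrow> (f has_derivative f' x) (at x)"
    and s: "\<And>v. diff_times_on k S (\<lambda>x. f' x v)"
  shows "diff_times_on (Suc k) S f"
proof -
  have "f' x = frechet_derivative f (at x)" if "x \<in> S" for x
    using frechet_derivative_at[OF d[OF that]] .
  then show ?thesis
    using d diff_times_on_cong[OF \<open>open S\<close> _ s] by (auto simp: differentiable_def)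
qed

lemma diff_times_on_SucD: "diff_times_on (Suc k) S f \<Longrightarrow> diff_times_on k S f"
proof (induction k arbitrary: f)
  case 0
  then show ?case
    by (auto intro!: continuous_at_imp_continuous_on differentiable_imp_continuous_within)
next
  case (Suc k)
  then show ?case by auto
qed

lemma diff_times_on_derivative:
  "diff_times_on (Suc k) S f \<Longrightarrow> x \<in> S \<Longrightarrow> (f has_derivative frechet_derivative f (at x)) (at x)"
  by (simp add: frechet_derivative_works)

lemma diff_times_on_const: "open S \<Longrightarrow> diff_times_on k S (\<lambda>x. c)"
proof (induction k arbitrary: c)
  case (Suc k)
  show ?case
    by (rule diff_times_on_SucI[OF Suc.prems has_derivative_const]) (use Suc in simp)
qed simp

lemma diff_times_on_bounded_linear:
  assumes "open S" "bounded_linear f"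
  shows "diff_times_on k S f"
proof (cases k)
  case 0
  then show ?thesis using assms(2) by (simp add: linear_continuous_on)
next
  case (Suc m)
  show ?thesis unfolding Suc
    by (rule diff_times_on_SucI[OF assms(1) bounded_linear_imp_has_derivative[OF assms(2)]])
      (rule diff_times_on_const[OF assms(1)])
qed

lemma diff_times_on_add:
  fixes f g :: "'a::real_normed_vector \<Rightarrow> 'b::real_normed_vector"
  assumes "open S"
  shows "diff_times_on k S f \<Longrightarrow> diff_times_on k S g \<Longrightarrow> diff_times_on k S (\<lambda>x. f x + g x)"
proof (induction k arbitrary: f g)
  case 0
  then show ?case by (simp add: continuous_on_add)
next
  case (Suc k)
  show ?case
    by (rule diff_times_on_SucI[OF assms has_derivative_add[OF diff_times_on_derivative[OF Suc.prems(1)]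
      diff_times_on_derivative[OF Suc.prems(2)]]]) (use Suc in auto)
qed

lemma diff_times_on_mult:
  fixes f g :: "'a::real_normed_vector \<Rightarrow> real"
  assumes "open S"
  shows "diff_times_on k S f \<Longrightarrow> diff_times_on k S g \<Longrightarrow> diff_times_on k S (\<lambda>x. f x * g x)"
proof (induction k arbitrary: f g)
  case 0
  then show ?case by (simp add: continuous_on_mult)
next
  case (Suc k)
  show ?case
    by (rule diff_times_on_SucI[OF assms has_derivative_mult[OF diff_times_on_derivative[OF Suc.prems(1)]
      diff_times_on_derivative[OF Suc.prems(2)]]])
      (use Suc diff_times_on_SucD[OF Suc.prems(1)] diff_times_on_SucD[OF Suc.prems(2)] in
        \<open>auto intro!: diff_times_on_add[OF assms]\<close>)
qed

text \<open>Radicands and denominators below are always positive, so real powers cover roots and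
  quotients alike.\<close>

lemma diff_times_on_powr:
  fixes f :: "'a::real_normed_vector \<Rightarrow> real"
  assumes "open S" and pos: "\<And>x. x \<in> S \<Longrightarrow> f x > 0"
  shows "diff_times_on k S f \<Longrightarrow> diff_times_on k S (\<lambda>x. f x powr a)"
proof (induction k arbitrary: a)
  case 0
  then show ?case using pos by (force intro!: continuous_on_powr)
next
  case (Suc k)
  have d: "((\<lambda>x. f x powr a) has_derivative (\<lambda>v. frechet_derivative f (at x) v * (a * f x powr (a - 1)))) (at x)"
    if "x \<in> S" for x
  proof -
    have "((\<lambda>t. t powr a) has_real_derivative a * f x powr (a - 1)) (at (f x))"
      using pos[OF that] by (auto intro!: derivative_eq_intros)
    from has_derivative_compose[OF diff_times_on_derivative[OF Suc.prems that]
        this[unfolded has_field_derivative_def]]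
    show ?thesis by (simp add: mult.commute)
  qed
  show ?case
    by (rule diff_times_on_SucI[OF assms(1) d])
      (use Suc diff_times_on_SucD[OF Suc.prems] in
        \<open>auto intro!: diff_times_on_mult[OF assms(1)] diff_times_on_const[OF assms(1)]\<close>)
qed

lemma smooth_on_cong: "open S \<Longrightarrow> smooth_on S f \<Longrightarrow> (\<And>x. x \<in> S \<Longrightarrow> f x = g x) \<Longrightarrow> smooth_on S g"
  unfolding smooth_on_def using diff_times_on_cong by metis

lemma smooth_on_subset:
  assumes "smooth_on S f" "T \<subseteq> S"
  shows "smooth_on T f"
proof -
  have "diff_times_on k S f \<Longrightarrow> diff_times_on k T f" for k
    using assms(2) by (induction k arbitrary: f) (auto intro: continuous_on_subset)
  then show ?thesis using assms(1) by (auto simp: smooth_on_def)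
qed

lemma smooth_on_continuous: "smooth_on S f \<Longrightarrow> continuous_on S f"
  unfolding smooth_on_def using diff_times_on.simps(1) by blast

lemma smooth_on_derivative:
  "smooth_on S f \<Longrightarrow> x \<in> S \<Longrightarrow> (f has_derivative frechet_derivative f (at x)) (at x)"
  unfolding smooth_on_def using diff_times_on_derivative by blast

lemma smooth_on_frechet_derivative:
  "smooth_on S f \<Longrightarrow> smooth_on S (\<lambda>x. frechet_derivative f (at x) v)"
  unfolding smooth_on_def using diff_times_on.simps(2) by blast

text \<open>A function need not be given in closed form to be smooth: closed forms of its directional
  derivatives are enough.  This is how elliptic integrals are dealt with below.\<close>

lemma smooth_onI_derivative:
  assumes "open S" "\<And>x. x \<in> S \<Longrightarrow> (f has_derivative f' x) (at x)" "\<And>v. smooth_on S (\<lambda>x. f' x v)"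
  shows "smooth_on S f"
  unfolding smooth_on_def
proof
  fix k
  have "diff_times_on (Suc k) S f"
    using assms by (intro diff_times_on_SucI) (auto simp: smooth_on_def)
  then show "diff_times_on k S f" by (rule diff_times_on_SucD)
qed

named_theorems smooth

lemma smooth_on_const [smooth]: "open S \<Longrightarrow> smooth_on S (\<lambda>x. c)"
  by (simp add: smooth_on_def diff_times_on_const)

lemma smooth_on_bounded_linear: "open S \<Longrightarrow> bounded_linear f \<Longrightarrow> smooth_on S f"
  by (simp add: smooth_on_def diff_times_on_bounded_linear)

lemma smooth_on_inner_right [smooth]:
  fixes c :: "'a::real_inner"
  shows "open S \<Longrightarrow> smooth_on S (\<lambda>y. c \<bullet> y)"
  by (rule smooth_on_bounded_linear) (auto intro: bounded_linear_inner_right)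

lemma smooth_on_component [smooth]: "open S \<Longrightarrow> smooth_on S (\<lambda>y::real^'n. y $ i)"
  by (rule smooth_on_bounded_linear) (auto intro: bounded_linear_vec_nth)

lemma smooth_on_add [smooth]:
  "open S \<Longrightarrow> smooth_on S f \<Longrightarrow> smooth_on S g \<Longrightarrow> smooth_on S (\<lambda>x. f x + g x)"
  by (simp add: smooth_on_def diff_times_on_add)

lemma smooth_on_mult [smooth]:
  fixes f g :: "'a::real_normed_vector \<Rightarrow> real"
  shows "open S \<Longrightarrow> smooth_on S f \<Longrightarrow> smooth_on S g \<Longrightarrow> smooth_on S (\<lambda>x. f x * g x)"
  by (simp add: smooth_on_def diff_times_on_mult)

lemma smooth_on_minus [smooth]:
  fixes f :: "'a::real_normed_vector \<Rightarrow> real"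
  shows "open S \<Longrightarrow> smooth_on S f \<Longrightarrow> smooth_on S (\<lambda>x. - f x)"
  using smooth_on_mult[of S "\<lambda>x. -1" f] smooth_on_const[of S "-1::real"] by simp

lemma smooth_on_diff [smooth]:
  fixes f g :: "'a::real_normed_vector \<Rightarrow> real"
  shows "open S \<Longrightarrow> smooth_on S f \<Longrightarrow> smooth_on S g \<Longrightarrow> smooth_on S (\<lambda>x. f x - g x)"
  using smooth_on_add[of S f "\<lambda>x. - g x"] smooth_on_minus[of S g] by simp

lemma smooth_on_powr [smooth]:
  fixes f :: "'a::real_normed_vector \<Rightarrow> real"
  shows "open S \<Longrightarrow> smooth_on S f \<Longrightarrow> (\<And>x. x \<in> S \<Longrightarrow> f x > 0) \<Longrightarrow> smooth_on S (\<lambda>x. f x powr a)"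
  by (simp add: smooth_on_def diff_times_on_powr)

lemma smooth_on_sqrt [smooth]:
  fixes f :: "'a::real_normed_vector \<Rightarrow> real"
  assumes "open S" "smooth_on S f" "\<And>x. x \<in> S \<Longrightarrow> f x > 0"
  shows "smooth_on S (\<lambda>x. sqrt (f x))"
  by (rule smooth_on_cong[OF assms(1) smooth_on_powr[OF assms, of "1/2"]])
    (use assms(3) in \<open>auto simp: powr_half_sqrt less_imp_le\<close>)

lemma smooth_on_divide [smooth]:
  fixes f g :: "'a::real_normed_vector \<Rightarrow> real"
  assumes "open S" "smooth_on S f" "smooth_on S g" "\<And>x. x \<in> S \<Longrightarrow> g x > 0"
  shows "smooth_on S (\<lambda>x. f x / g x)"
  by (rule smooth_on_cong[OF assms(1)
        smooth_on_mult[OF assms(1,2) smooth_on_powr[OF assms(1,3,4), of "-1"]]])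
    (use assms(4) in \<open>auto simp: powr_minus divide_inverse less_imp_le\<close>)

lemma smooth_on_power [smooth]:
  fixes f :: "'a::real_normed_vector \<Rightarrow> real"
  shows "open S \<Longrightarrow> smooth_on S f \<Longrightarrow> smooth_on S (\<lambda>x. f x ^ m)"
  by (induction m) (auto intro: smooth_on_const smooth_on_mult)

section \<open>Partial derivatives\<close>

lemma partial_eq:
  fixes f :: "real^'n \<Rightarrow> real"
  assumes "(f has_derivative f') (at x)"
  shows "partial i f x = f' (axis i 1)"
proof -
  have "((\<lambda>t. x + t *\<^sub>R axis i 1) has_derivative (\<lambda>t. t *\<^sub>R axis i 1)) (at 0)"
    by (auto intro!: derivative_eq_intros)
  from has_derivative_compose[OF this, of f f'] assms
  have "((\<lambda>t. f (x + t *\<^sub>R axis i 1)) has_derivative (\<lambda>t. f' (t *\<^sub>R axis i 1))) (at 0)"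
    by simp
  moreover have "(\<lambda>t. f' (t *\<^sub>R axis i 1)) = (*) (f' (axis i 1))"
    using linear_scale[OF has_derivative_linear[OF assms]] by (auto simp: mult.commute)
  ultimately show ?thesis
    unfolding partial_def by (simp add: has_field_derivative_def DERIV_imp_deriv)
qed

lemma partial_cong:
  fixes f g :: "real^'n \<Rightarrow> real"
  assumes "open A" "x \<in> A" "\<And>y. y \<in> A \<Longrightarrow> f y = g y"
  shows "partial i f x = partial i g x"
proof -
  let ?c = "\<lambda>t. x + t *\<^sub>R axis i 1 :: real^'n"
  have "open (?c -` A)"
    by (intro open_vimage assms(1) continuous_intros)
  then have "\<forall>\<^sub>F t in nhds 0. ?c t \<in> A"
    using assms(2) by (force simp: eventually_nhds)
  then have "\<forall>\<^sub>F t in nhds 0. f (?c t) = g (?c t)"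
    by eventually_elim (use assms(3) in auto)
  then show ?thesis unfolding partial_def by (rule deriv_cong_ev) simp
qed

lemma smooth_on_partial [smooth]:
  fixes f :: "real^'n \<Rightarrow> real"
  assumes "open S" "smooth_on S f"
  shows "smooth_on S (partial i f)"
  by (rule smooth_on_cong[OF assms(1) smooth_on_frechet_derivative[OF assms(2), of "axis i 1"]])
    (simp add: partial_eq[OF smooth_on_derivative[OF assms(2)]])

section \<open>Arc length of the indicatrix as a function of the polar angle\<close>

definition signed_integral :: "(real \<Rightarrow> real) \<Rightarrow> real \<Rightarrow> real" where
  "signed_integral h \<phi> = (if 0 \<le> \<phi> then integral {0..\<phi>} h else - integral {\<phi>..0} h)"

lemma signed_integral_0 [simp]: "signed_integral h 0 = 0"
  by (simp add: signed_integral_def)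

text \<open>Moving the base point below both limits turns the signed integral into ordinary ones, to which
  the fundamental theorem of calculus applies on either side of \<open>0\<close>.\<close>

lemma signed_integral_shift:
  assumes "continuous_on UNIV h" "-K \<le> \<phi>" "0 \<le> K"
  shows "signed_integral h \<phi> = integral {-K..\<phi>} h - integral {-K..0} h"
proof -
  have i: "h integrable_on {a..b}" for a b
    using assms(1) by (auto intro: integrable_continuous_real continuous_on_subset)
  show ?thesis
    using assms Henstock_Kurzweil_Integration.integral_combine[OF _ _ i, of "-K" 0 \<phi>]
      Henstock_Kurzweil_Integration.integral_combine[OF _ _ i, of "-K" \<phi> 0]
    by (auto simp: signed_integral_def)
qed

lemma signed_integral_has_derivative:
  assumes "continuous_on UNIV h"
  shows "(signed_integral h has_real_derivative h \<phi>) (at \<phi>)"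
proof -
  define K where "K = \<bar>\<phi>\<bar> + 1"
  have "((\<lambda>t. integral {-K..t} h) has_real_derivative h \<phi>) (at \<phi> within {-K..K})"
    using assms by (intro integral_has_real_derivative) (auto intro: continuous_on_subset simp: K_def)
  then have "((\<lambda>t. integral {-K..t} h) has_real_derivative h \<phi>) (at \<phi>)"
    using at_within_Icc_at[of "-K" \<phi> K] by (auto simp: K_def)
  then have "((\<lambda>t. integral {-K..t} h - integral {-K..0} h) has_real_derivative h \<phi>) (at \<phi>)"
    by (auto intro!: derivative_eq_intros)
  then show ?thesis
    by (rule has_field_derivative_transform_within_open[where S = "{-K<..<K}"])
      (use signed_integral_shift[OF assms, of K] in \<open>auto simp: K_def\<close>)
qed

text \<open>Along the unit circle \<open>p = cos \<phi>\<close>, \<open>q = sin \<phi>\<close> of an orthonormal coframe adapted to \<open>b\<close>, the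
  form \<open>m\<^sub>i dy\<^sup>i / F\<close> restricts to \<open>d\<phi> / \<surd>(1 + c cos \<phi>)\<close>.\<close>

definition arc_rate :: "real \<Rightarrow> real \<Rightarrow> real" where
  "arc_rate c s = 1 / sqrt (1 + c * cos s)"

definition arc_length :: "real \<Rightarrow> real \<Rightarrow> real" where
  "arc_length c \<phi> = signed_integral (arc_rate c) \<phi>"

text \<open>The derivative of \<open>arc_length\<close> with respect to the parameter \<open>c\<close>.\<close>

definition arc_length_deriv :: "real \<Rightarrow> real \<Rightarrow> real" where
  "arc_length_deriv c \<phi> = signed_integral (\<lambda>s. - (1/2) * cos s * arc_rate c s ^ 3) \<phi>"

lemma one_plus_cos_pos: "\<bar>c\<bar> < 1 \<Longrightarrow> 1 + c * cos s > (0::real)"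
proof -
  assume c: "\<bar>c\<bar> < 1"
  have "\<bar>c * cos s\<bar> \<le> \<bar>c\<bar>"
    using mult_left_mono[OF abs_cos_le_one[of s], of "\<bar>c\<bar>"] by (simp add: abs_mult)
  then show ?thesis using c by linarith
qed

lemma arc_rate_power2: "\<bar>c\<bar> < 1 \<Longrightarrow> (arc_rate c s)\<^sup>2 * (1 + c * cos s) = 1"
  using one_plus_cos_pos[of c s] by (simp add: arc_rate_def power_divide)

lemma continuous_on_arc_rate [continuous_intros]:
  fixes f g :: "'a::t2_space \<Rightarrow> real"
  assumes "continuous_on A f" "continuous_on A g" "\<And>x. x \<in> A \<Longrightarrow> \<bar>f x\<bar> < 1"
  shows "continuous_on A (\<lambda>x. arc_rate (f x) (g x))"
  unfolding arc_rate_def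
  by (intro continuous_intros assms) (use assms(3) one_plus_cos_pos in \<open>force dest: less_imp_neq\<close>)

lemma DERIV_inverse_sqrt:
  assumes "u > 0"
  shows "((\<lambda>t. 1 / sqrt t) has_real_derivative - (1/2) * (1 / sqrt u) ^ 3) (at u)"
proof -
  have "((\<lambda>t. inverse (sqrt t)) has_real_derivative - (1/2) * (1 / sqrt u) ^ 3) (at u)"
    by (rule DERIV_cong[OF DERIV_inverse'[OF DERIV_real_sqrt]])
      (use assms in \<open>auto simp: power3_eq_cube field_simps\<close>)
  then show ?thesis by (simp only: inverse_eq_divide)
qed

lemma DERIV_arc_rate [derivative_intros]:
  assumes "\<bar>c\<bar> < 1" "(g has_real_derivative g') (at s within A)"
  shows "((\<lambda>s. arc_rate c (g s)) has_real_derivative (c/2 * sin (g s) * arc_rate c (g s) ^ 3 * g')) (at s within A)"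
proof -
  have "((\<lambda>s. 1 + c * cos (g s)) has_real_derivative - (c * sin (g s) * g')) (at s within A)"
    using assms(2) by (auto intro!: derivative_eq_intros)
  from DERIV_chain2[OF DERIV_inverse_sqrt[OF one_plus_cos_pos[OF assms(1)]] this]
  show ?thesis by (simp add: arc_rate_def mult_ac)
qed

lemma DERIV_arc_rate_param:
  assumes "\<bar>c\<bar> < 1"
  shows "((\<lambda>c. arc_rate c s) has_real_derivative (- (1/2) * cos s * arc_rate c s ^ 3)) (at c within A)"
proof -
  have "((\<lambda>c. 1 + c * cos s) has_real_derivative cos s) (at c within A)"
    by (auto intro!: derivative_eq_intros)
  from DERIV_chain2[OF DERIV_inverse_sqrt[OF one_plus_cos_pos[OF assms]] this]
  show ?thesis by (simp add: arc_rate_def mult_ac)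
qed

lemma DERIV_arc_length: "\<bar>c\<bar> < 1 \<Longrightarrow> (arc_length c has_real_derivative arc_rate c \<phi>) (at \<phi>)"
  unfolding arc_length_def by (intro signed_integral_has_derivative continuous_intros)

lemma DERIV_arc_length_deriv:
  "\<bar>c\<bar> < 1 \<Longrightarrow> (arc_length_deriv c has_real_derivative (- (1/2) * cos \<phi> * arc_rate c \<phi> ^ 3)) (at \<phi>)"
  unfolding arc_length_deriv_def
  by (rule signed_integral_has_derivative) (intro continuous_intros)

lemma DERIV_arc_length_param:
  assumes "c \<in> {-1<..<1}"
  shows "((\<lambda>c. arc_length c \<phi>) has_real_derivative arc_length_deriv c \<phi>) (at c within {-1<..<1})"
proof -
  have L: "((\<lambda>c. integral (cbox a b) (arc_rate c)) has_real_derivative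
      integral (cbox a b) (\<lambda>s. - (1/2) * cos s * arc_rate c s ^ 3)) (at c within {-1<..<1})" for a b
  proof (rule leibniz_rule_field_derivative[OF _ _ _ assms])
    show "((\<lambda>c. arc_rate c t) has_real_derivative - (1/2) * cos t * arc_rate c t ^ 3) (at c within {-1<..<1})"
      if "c \<in> {-1<..<1}" for c t
      using that by (intro DERIV_arc_rate_param) auto
    show "arc_rate c integrable_on cbox a b" if "c \<in> {-1<..<1}" for c
      using that by (intro integrable_continuous continuous_intros) auto
    show "continuous_on ({-1<..<1} \<times> cbox a b) (\<lambda>(c, t). - (1/2) * cos t * arc_rate c t ^ 3)"
      unfolding split_beta by (intro continuous_intros) auto
  qed auto
  show ?thesis
    unfolding arc_length_def arc_length_deriv_def signed_integral_def
    using L[of 0 \<phi>] DERIV_minus[OF L[of \<phi> 0]] by auto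
qed

text \<open>Joint differentiability in parameter and angle is what the chain rule needs when the base
  point \<open>x\<close> moves, because both \<open>c\<close> and the polar angle depend on \<open>x\<close>.\<close>

lemma arc_length_has_derivative:
  assumes "\<bar>c\<bar> < 1"
  shows "((\<lambda>(c, \<phi>). arc_length c \<phi>) has_derivative
     (\<lambda>(tc, t\<phi>). arc_length_deriv c \<phi> * tc + arc_rate c \<phi> * t\<phi>)) (at (c, \<phi>))"
proof -
  let ?X = "{-1<..<1::real}"
  have c: "c \<in> ?X" using assms by auto
  have op: "open (?X \<times> (UNIV::real set))" by (simp add: open_Times)
  have "continuous_on (?X \<times> UNIV) (\<lambda>(c, \<phi>). arc_rate c \<phi>)"
    unfolding split_beta by (intro continuous_intros) auto
  then have "continuous (at (c, \<phi>) within ?X \<times> UNIV) (\<lambda>(c, \<phi>). arc_rate c \<phi>)"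
    using c by (simp add: continuous_on_eq_continuous_within)
  then have "continuous (at (c, \<phi>) within ?X \<times> UNIV) (\<lambda>z. blinfun_mult_right (case z of (c, \<phi>) \<Rightarrow> arc_rate c \<phi>))"
    by (rule bounded_linear.continuous[OF bounded_linear_blinfun_mult_right])
  then have cont: "continuous (at (c, \<phi>) within ?X \<times> UNIV) (\<lambda>(c, \<phi>). blinfun_mult_right (arc_rate c \<phi>))"
    by (simp only: case_prod_unfold)
  have "((\<lambda>(c, \<phi>). arc_length c \<phi>) has_derivative
     (\<lambda>(tc, t\<phi>). arc_length_deriv c \<phi> * tc + blinfun_apply (blinfun_mult_right (arc_rate c \<phi>)) t\<phi>)) (at (c, \<phi>) within ?X \<times> UNIV)"
  proof (rule has_derivative_partialsI[OF _ _ cont])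
    show "((\<lambda>c. arc_length c \<phi>) has_derivative (\<lambda>tc. arc_length_deriv c \<phi> * tc)) (at c within ?X)"
      using DERIV_arc_length_param[OF c, of \<phi>] by (simp add: has_field_derivative_def)
    show "(arc_length c has_derivative blinfun_apply (blinfun_mult_right (arc_rate c \<phi>))) (at \<phi> within UNIV)"
      if "c \<in> ?X" for c \<phi>
      using DERIV_arc_length[of c \<phi>] that by (simp add: has_field_derivative_def abs_less_iff)
  qed auto
  then show ?thesis
    using at_within_open[OF _ op, of "(c, \<phi>)"] c by simp
qed

section \<open>The angular profile of the connection\<close>

text \<open>Here \<open>d\<close> stands for \<open>\<partial>c/\<partial>x\<^sup>n\<close> and \<open>h\<close> for the part \<open>d (\<partial>G/\<partial>c) - k\<^sub>n\<close> of \<open>\<partial>\<theta>/\<partial>x\<^sup>n - k\<^sub>n\<close>.  Up to a term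
  linear in \<open>y\<close>, the coefficients \<open>N\<close> are \<open>S V1(\<psi>)\<close> and \<open>S V2(\<psi>)\<close> in the adapted frame, and the
  covector \<open>F\<^sub>k\<close> is \<open>(cos \<psi> + c, sin \<psi>)\<close>.\<close>

locale connection_profile =
  fixes c d :: real and h :: "real \<Rightarrow> real"
  assumes c: "\<bar>c\<bar> < 1"
    and DERIV_h: "\<And>s. (h has_real_derivative - (1/2) * d * cos s * arc_rate c s ^ 3) (at s)"
begin

definition V1 :: "real \<Rightarrow> real" where
  "V1 s = - d * (cos s)\<^sup>2 * (arc_rate c s)\<^sup>2 + arc_rate c s * sin s * h s"
definition V2 :: "real \<Rightarrow> real" where
  "V2 s = - d * cos s * sin s * (arc_rate c s)\<^sup>2 - arc_rate c s * (c + cos s) * h s"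

definition V1' :: "real \<Rightarrow> real" where
  "V1' s = 2 * d * cos s * sin s * (arc_rate c s)\<^sup>2 - d * c * (cos s)\<^sup>2 * sin s * arc_rate c s ^ 4
     + c/2 * (sin s)\<^sup>2 * arc_rate c s ^ 3 * h s + arc_rate c s * cos s * h s
     - d/2 * sin s * cos s * arc_rate c s ^ 4"
definition V2' :: "real \<Rightarrow> real" where
  "V2' s = - d * (((cos s)\<^sup>2 - (sin s)\<^sup>2) * (arc_rate c s)\<^sup>2 + c * cos s * (sin s)\<^sup>2 * arc_rate c s ^ 4)
     - c/2 * sin s * arc_rate c s ^ 3 * (c + cos s) * h s + arc_rate c s * sin s * h s
     + d/2 * arc_rate c s ^ 4 * cos s * (c + cos s)"

lemma DERIV_V1: "(V1 has_real_derivative V1' s) (at s)"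
  unfolding V1_def[abs_def]
  by (rule derivative_eq_intros c refl DERIV_h)+
    (simp add: V1'_def power2_eq_square power3_eq_cube power4_eq_xxxx algebra_simps)

lemma DERIV_V2: "(V2 has_real_derivative V2' s) (at s)"
  unfolding V2_def[abs_def]
  by (rule derivative_eq_intros c refl DERIV_h)+
    (simp add: V2'_def power2_eq_square power3_eq_cube power4_eq_xxxx algebra_simps)

lemma second_derivatives:
  obtains V1'' V2'' where "\<And>s. (V1' has_real_derivative V1'' s) (at s)" "\<And>s. (V2' has_real_derivative V2'' s) (at s)"
proof -
  have "\<exists>D. (V1' has_real_derivative D) (at s)" for s
    unfolding V1'_def[abs_def] by (rule exI) (rule derivative_intros c DERIV_h)+
  moreover have "\<exists>D. (V2' has_real_derivative D) (at s)" for s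
    unfolding V2'_def[abs_def] by (rule exI) (rule derivative_intros c DERIV_h)+
  ultimately show ?thesis using that by metis
qed

lemma arc_rate_relation: "(arc_rate c s)\<^sup>2 * (1 + c * cos s) = 1"
  using c by (rule arc_rate_power2)

text \<open>The next identity is the condition \<open>d\<^sub>n F = 0\<close>, the one after it is \<open>d\<^sub>n \<theta> = k\<^sub>n\<close>, both with the
  linear term removed.\<close>

lemma V_along_F: "(cos s + c) * V1 s + sin s * V2 s = - d * cos s"
proof -
  have "(cos s + c) * V1 s + sin s * V2 s
      = - d * cos s * ((arc_rate c s)\<^sup>2 * ((cos s)\<^sup>2 + (sin s)\<^sup>2 + c * cos s))"
    unfolding V1_def V2_def by algebra
  then show ?thesis using arc_rate_relation[of s] by simp
qed

lemma V_along_m: "cos s * V2 s - sin s * V1 s = - h s * arc_rate c s * (1 + c * cos s)"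
proof -
  have "cos s * V2 s - sin s * V1 s = - h s * arc_rate c s * ((cos s)\<^sup>2 + (sin s)\<^sup>2 + c * cos s)"
    unfolding V1_def V2_def by algebra
  then show ?thesis by simp
qed

lemma V_radial: "cos s * V1 s + sin s * V2 s = - d * cos s * (arc_rate c s)\<^sup>2 - c * arc_rate c s * sin s * h s"
proof -
  have "cos s * V1 s + sin s * V2 s = - d * cos s * (arc_rate c s)\<^sup>2 * ((cos s)\<^sup>2 + (sin s)\<^sup>2) - c * arc_rate c s * sin s * h s"
    unfolding V1_def V2_def by algebra
  then show ?thesis by simp
qed

text \<open>Differentiating \<open>V_along_F\<close> twice and \<open>V_along_m\<close> once determines the contraction without the
  explicit second derivatives: with \<open>w = (cos + c, sin)\<close> one has \<open>w \<bullet> V'' = (w \<bullet> V)'' - w'' \<bullet> V - 2 w' \<bullet> V'\<close>,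
  and \<open>w'\<close> is the unit vector occurring in \<open>V_along_m\<close>.  The derivative of \<open>h\<close> enters only through the
  latter; this is where the value of \<open>\<partial>\<^sup>2G / \<partial>c \<partial>\<psi>\<close> matters.\<close>

lemma profile_contraction:
  assumes V1'': "\<And>s. (V1' has_real_derivative V1'' s) (at s)" and V2'': "\<And>s. (V2' has_real_derivative V2'' s) (at s)"
  shows "(cos s + c) * (V1 s + V1'' s) + sin s * (V2 s + V2'' s) = 0"
proof -
  have 1: "(cos s + c) * V1' s - sin s * V1 s + (cos s * V2 s + sin s * V2' s) = d * sin s" for s
  proof (rule DERIV_unique)
    show "((\<lambda>s. (cos s + c) * V1 s + sin s * V2 s) has_real_derivative
        (cos s + c) * V1' s - sin s * V1 s + (cos s * V2 s + sin s * V2' s)) (at s)"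
      by (rule derivative_eq_intros refl DERIV_V1 DERIV_V2)+ (simp add: algebra_simps)
    show "((\<lambda>s. (cos s + c) * V1 s + sin s * V2 s) has_real_derivative d * sin s) (at s)"
      unfolding V_along_F by (rule derivative_eq_intros refl)+ simp
  qed
  have 2: "(cos s + c) * V1'' s - 2 * sin s * V1' s - cos s * V1 s
      + (sin s * V2'' s + 2 * cos s * V2' s - sin s * V2 s) = d * cos s"
  proof (rule DERIV_unique)
    show "((\<lambda>s. (cos s + c) * V1' s - sin s * V1 s + (cos s * V2 s + sin s * V2' s)) has_real_derivative
        (cos s + c) * V1'' s - 2 * sin s * V1' s - cos s * V1 s
        + (sin s * V2'' s + 2 * cos s * V2' s - sin s * V2 s)) (at s)"
      by (rule derivative_eq_intros refl DERIV_V1 DERIV_V2 V1'' V2'')+ (simp add: algebra_simps)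
    show "((\<lambda>s. (cos s + c) * V1' s - sin s * V1 s + (cos s * V2 s + sin s * V2' s)) has_real_derivative
        d * cos s) (at s)"
      unfolding 1 by (rule derivative_eq_intros refl)+ simp
  qed
  have 3: "cos s * V2' s - sin s * V2 s - (sin s * V1' s + cos s * V1 s)
      = d/2 * cos s * (arc_rate c s)\<^sup>2 + c/2 * sin s * arc_rate c s * h s"
  proof (rule DERIV_unique)
    show "((\<lambda>s. cos s * V2 s - sin s * V1 s) has_real_derivative
        cos s * V2' s - sin s * V2 s - (sin s * V1' s + cos s * V1 s)) (at s)"
      by (rule derivative_eq_intros refl DERIV_V1 DERIV_V2)+ (simp add: algebra_simps)
    have "((\<lambda>s. - h s * arc_rate c s * (1 + c * cos s)) has_real_derivative
        (d/2 * cos s * (arc_rate c s)\<^sup>2 - c/2 * sin s * arc_rate c s * h s) * ((arc_rate c s)\<^sup>2 * (1 + c * cos s))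
        + c * sin s * arc_rate c s * h s) (at s)"
      by (rule derivative_eq_intros refl DERIV_h c)+
        (simp add: power2_eq_square power3_eq_cube add_divide_distrib algebra_simps)
    then show "((\<lambda>s. cos s * V2 s - sin s * V1 s) has_real_derivative
        d/2 * cos s * (arc_rate c s)\<^sup>2 + c/2 * sin s * arc_rate c s * h s) (at s)"
      unfolding V_along_m arc_rate_relation by (simp add: field_simps)
  qed
  show ?thesis
    using V_along_F[of s] V_radial[of s] 2 3 by argo
qed

end

section \<open>Dual frames in the plane\<close>

lemma inner_2: "(x::real^2) \<bullet> y = x $ 1 * y $ 1 + x $ 2 * y $ 2"
  by (simp add: inner_vec_def sum_2)

lemma dual_frame_expand:
  fixes b n e f y :: "real^2"
  assumes "b \<bullet> e = 1" "n \<bullet> f = 1" "b \<bullet> f = 0" "n \<bullet> e = 0"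
  shows "y = (b \<bullet> y) *\<^sub>R e + (n \<bullet> y) *\<^sub>R f"
proof -
  define D where "D = b $ 1 * n $ 2 - b $ 2 * n $ 1"
  have "D * (e $ 1 * f $ 2 - e $ 2 * f $ 1) = (b \<bullet> e) * (n \<bullet> f) - (b \<bullet> f) * (n \<bullet> e)"
    by (simp add: D_def inner_2 algebra_simps)
  then have D: "D \<noteq> 0" using assms by auto
  define z where "z = y - (b \<bullet> y) *\<^sub>R e - (n \<bullet> y) *\<^sub>R f"
  have z: "b \<bullet> z = 0" "n \<bullet> z = 0"
    using assms by (simp_all add: z_def inner_simps)
  have "D * z $ 1 = n $ 2 * (b \<bullet> z) - b $ 2 * (n \<bullet> z)" "D * z $ 2 = b $ 1 * (n \<bullet> z) - n $ 1 * (b \<bullet> z)"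
    by (simp_all add: D_def inner_2 algebra_simps)
  then have "z = 0" using D z by (simp add: vec_eq_iff forall_2)
  then show ?thesis by (simp add: z_def algebra_simps)
qed

lemma matrix_inv_mult_vec:
  fixes A :: "real^'n^'n"
  assumes "\<And>z. A *v z = 0 \<Longrightarrow> z = 0"
  shows "A *v (matrix_inv A *v z) = z" "matrix_inv A *v (A *v z) = z"
proof -
  have "invertible A"
    using assms matrix_left_invertible_ker invertible_left_inverse by blast
  then have "A ** matrix_inv A = mat 1 \<and> matrix_inv A ** A = mat 1"
    unfolding invertible_def matrix_inv_def by (rule someI_ex)
  then show "A *v (matrix_inv A *v z) = z" "matrix_inv A *v (A *v z) = z"
    by (simp_all add: matrix_vector_mul_assoc)
qed

text \<open>A symmetric tensor that is the sum of the squares of a coframe has the squares of the dual frame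
  as its inverse.  This raises the index of \<open>m\<^sub>i\<close> without inverting the fundamental tensor.\<close>

lemma matrix_inv_dual_frame:
  fixes b n e f :: "real^2"
  assumes dual: "b \<bullet> e = 1" "n \<bullet> f = 1" "b \<bullet> f = 0" "n \<bullet> e = 0"
    and A: "\<And>z. A *v z = (b \<bullet> z) *\<^sub>R b + (n \<bullet> z) *\<^sub>R n"
  shows "matrix_inv A *v n = f"
proof -
  have "z = 0" if "A *v z = 0" for z
  proof -
    have "(A *v z) \<bullet> e = b \<bullet> z" "(A *v z) \<bullet> f = n \<bullet> z"
      unfolding A using dual by (simp_all add: inner_simps)
    then show ?thesis using that dual_frame_expand[OF dual, of z] by simp
  qed
  then have "matrix_inv A *v (A *v f) = f"
    by (rule matrix_inv_mult_vec)
  then show ?thesis using dual by (simp add: A)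
qed

section \<open>The metric function in the adapted coframe\<close>

locale randers_surface =
  fixes U :: "(real^2) set" and R :: randers
  assumes randers: "randers_on U R"
begin

abbreviation p :: "real^2 \<Rightarrow> real^2 \<Rightarrow> real" where "p x y \<equiv> covb R x \<bullet> y"
abbreviation q :: "real^2 \<Rightarrow> real^2 \<Rightarrow> real" where "q x y \<equiv> covn R x \<bullet> y"
abbreviation c :: "real^2 \<Rightarrow> real" where "c x \<equiv> bnorm R x"

definition e1 :: "real^2 \<Rightarrow> real^2" where "e1 x = ainv R x *v covb R x"
definition e2 :: "real^2 \<Rightarrow> real^2" where "e2 x = ainv R x *v covn R x"

lemma open_U: "open U"
  using randers by (simp add: randers_on_def)

lemma c_bounds: "x \<in> U \<Longrightarrow> 0 < c x \<and> c x < 1"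
  using randers by (simp add: randers_on_def)

lemma c_abs: "x \<in> U \<Longrightarrow> \<bar>c x\<bar> < 1"
  using c_bounds[of x] by simp

lemma metric_frame:
  assumes "x \<in> U"
  shows "metric R x *v e1 x = covb R x" "metric R x *v e2 x = covn R x"
proof -
  have "z = 0" if "metric R x *v z = 0" for z
    using randers that assms by (force simp: randers_on_def)
  then show "metric R x *v e1 x = covb R x" "metric R x *v e2 x = covn R x"
    unfolding e1_def e2_def ainv_def by (simp_all add: matrix_inv_mult_vec)
qed

lemma frame_dual:
  assumes "x \<in> U"
  shows "p x (e1 x) = 1" "q x (e2 x) = 1" "p x (e2 x) = 0" "q x (e1 x) = 0"
proof -
  have sym: "transpose (metric R x) = metric R x"
    using randers assms by (simp add: randers_on_def)
  show "p x (e1 x) = 1" "q x (e2 x) = 1" and *: "p x (e2 x) = 0"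
    using randers assms by (simp_all add: randers_on_def e1_def e2_def)
  have "p x (e2 x) = e1 x \<bullet> (metric R x *v e2 x)"
    by (metis metric_frame(1)[OF assms] dot_lmul_matrix transpose_matrix_vector sym)
  then show "q x (e1 x) = 0"
    using * metric_frame(2)[OF assms] by (simp add: inner_commute)
qed

lemma frame_expand: "x \<in> U \<Longrightarrow> y = p x y *\<^sub>R e1 x + q x y *\<^sub>R e2 x"
  by (rule dual_frame_expand[OF frame_dual])

lemma coframe_eq_0_imp: "x \<in> U \<Longrightarrow> p x y = 0 \<Longrightarrow> q x y = 0 \<Longrightarrow> y = 0"
  using frame_expand[of x y] by simp

lemma coframe_norm_pos: "x \<in> U \<Longrightarrow> y \<noteq> 0 \<Longrightarrow> (p x y)\<^sup>2 + (q x y)\<^sup>2 > 0"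
  using coframe_eq_0_imp[of x y] by (metis sum_power2_gt_zero_iff)

text \<open>In dimension two, the orthonormal pair of covectors is a full coframe, so that \<open>a\<close> is the sum of
  their squares.\<close>

lemma SS_eq:
  assumes "x \<in> U"
  shows "SS R x y = sqrt ((p x y)\<^sup>2 + (q x y)\<^sup>2)"
proof -
  have "metric R x *v y = metric R x *v (p x y *\<^sub>R e1 x + q x y *\<^sub>R e2 x)"
    using frame_expand[OF assms, of y] by simp
  also have "\<dots> = p x y *\<^sub>R covb R x + q x y *\<^sub>R covn R x"
    using metric_frame[OF assms] by (simp add: matrix_vector_right_distrib matrix_vector_mult_scaleR)
  finally show ?thesis
    by (simp add: SS_def inner_simps inner_commute power2_eq_square)
qed

lemma SS_pos: "x \<in> U \<Longrightarrow> y \<noteq> 0 \<Longrightarrow> SS R x y > 0"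
  using coframe_norm_pos[of x y] by (simp add: SS_eq)

lemma SS_power2: "x \<in> U \<Longrightarrow> (SS R x y)\<^sup>2 = (p x y)\<^sup>2 + (q x y)\<^sup>2"
  by (simp add: SS_eq)

lemma FF_eq: "FF R x y = SS R x y + c x * p x y"
  by (simp add: FF_def b_form_def b_low_def)

lemma FF_pos:
  assumes "x \<in> U" "y \<noteq> 0"
  shows "FF R x y > 0"
proof -
  have "\<bar>p x y\<bar> \<le> SS R x y" using assms by (simp add: SS_eq)
  then have "\<bar>c x * p x y\<bar> \<le> c x * SS R x y"
    using c_bounds[OF assms(1)] by (simp add: abs_mult)
  also have "\<dots> < SS R x y"
    using c_bounds[OF assms(1)] SS_pos[OF assms] by simp
  finally show ?thesis by (simp add: FF_eq abs_less_iff)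
qed

lemma m_low_eq:
  assumes "x \<in> U" "y \<noteq> 0"
  shows "m_low R x y = (sqrt (FF R x y / SS R x y) / SS R x y) *\<^sub>R
     (p x y *\<^sub>R covn R x - q x y *\<^sub>R covb R x)"
  using c_bounds[OF assms(1)]
  by (simp add: m_low_def b_form_def n_form_def b_low_def vec_eq_iff field_simps)

lemma b_up_eq: "x \<in> U \<Longrightarrow> b_up R x = c x *\<^sub>R e1 x"
  by (simp add: b_up_def b_low_def e1_def matrix_vector_mult_scaleR)

text \<open>The covector \<open>\<partial>F/\<partial>y\<^sup>i\<close>.\<close>

definition F_low :: "real^2 \<Rightarrow> real^2 \<Rightarrow> real^2" where
  "F_low x y = (1 / SS R x y) *\<^sub>R (p x y *\<^sub>R covb R x + q x y *\<^sub>R covn R x) + c x *\<^sub>R covb R x"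

lemma SS_has_derivative:
  assumes "x \<in> U" "y \<noteq> 0"
  shows "(SS R x has_derivative (\<lambda>v. (p x y * p x v + q x y * q x v) / SS R x y)) (at y)"
proof -
  have "((\<lambda>y. (p x y)\<^sup>2 + (q x y)\<^sup>2) has_derivative (\<lambda>v. 2 * (p x y * p x v + q x y * q x v))) (at y)"
    by (auto intro!: derivative_eq_intros ext simp: algebra_simps)
  from has_derivative_compose[OF this DERIV_real_sqrt[OF coframe_norm_pos[OF assms], unfolded has_field_derivative_def]]
  have "((\<lambda>y. sqrt ((p x y)\<^sup>2 + (q x y)\<^sup>2)) has_derivative
     (\<lambda>v. (p x y * p x v + q x y * q x v) / sqrt ((p x y)\<^sup>2 + (q x y)\<^sup>2))) (at y)"
    by (simp add: inverse_eq_divide del: distrib_left_numeral)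
  moreover have "SS R x = (\<lambda>y. sqrt ((p x y)\<^sup>2 + (q x y)\<^sup>2))"
    by (intro ext SS_eq assms)
  ultimately show ?thesis by simp
qed

lemma FF_has_derivative:
  assumes "x \<in> U" "y \<noteq> 0"
  shows "(FF R x has_derivative (\<lambda>v. F_low x y \<bullet> v)) (at y)"
proof -
  have "((\<lambda>y. SS R x y + c x * p x y) has_derivative (\<lambda>v. F_low x y \<bullet> v)) (at y)"
    by (rule derivative_eq_intros SS_has_derivative[OF assms] refl)+
      (simp add: F_low_def inner_simps fun_eq_iff add_divide_distrib algebra_simps)
  then show ?thesis by (simp add: FF_eq[abs_def])
qed

lemma SS_smooth [smooth]: "x \<in> U \<Longrightarrow> smooth_on (-{0}) (SS R x)"
  by (rule smooth_on_cong[where f="\<lambda>y. sqrt ((p x y)\<^sup>2 + (q x y)\<^sup>2)"])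
    (auto intro!: smooth coframe_norm_pos simp: SS_eq)

lemma FF_smooth [smooth]: "x \<in> U \<Longrightarrow> smooth_on (-{0}) (FF R x)"
  by (rule smooth_on_cong[where f="\<lambda>y. SS R x y + c x * p x y"]) (auto intro!: smooth simp: FF_eq)

text \<open>In dimension two the angular metric \<open>F F\<^sub>i\<^sub>j\<close> has rank one, and \<open>m\<^sub>i\<close> is normalised to be its
  square root; so the fundamental tensor is \<open>F\<^sub>i F\<^sub>j + m\<^sub>i m\<^sub>j\<close>.\<close>

lemma F_low_has_derivative:
  assumes "x \<in> U" "y \<noteq> 0"
  shows "((\<lambda>y. FF R x y * F_low x y $ j) has_derivative
    (\<lambda>v. (F_low x y \<bullet> v) * F_low x y $ j + (m_low R x y \<bullet> v) * m_low R x y $ j)) (at y)"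
proof -
  have S: "SS R x y > 0" "FF R x y > 0" using assms by (auto intro: SS_pos FF_pos)
  let ?A = "\<lambda>y. p x y * covb R x $ j + q x y * covn R x $ j"
  have A: "(?A has_derivative ?A) (at y)"
    by (auto intro!: derivative_eq_intros)
  have "((\<lambda>y. ?A y / SS R x y) has_derivative (\<lambda>v. (?A v * SS R x y - ?A y * ((p x y * p x v + q x y * q x v) / SS R x y))
      / (SS R x y * SS R x y))) (at y)"
    using S by (intro has_derivative_divide' A SS_has_derivative assms) auto
  then have "((\<lambda>y. ?A y / SS R x y + c x * covb R x $ j) has_derivative
      (\<lambda>v. ?A v / SS R x y - (p x y * p x v + q x y * q x v) * ?A y / SS R x y ^ 3)) (at y)"
    using S by (intro has_derivative_eq_rhs[OF has_derivative_add_const])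
      (auto simp: fun_eq_iff diff_divide_distrib power3_eq_cube mult_ac)
  from has_derivative_mult[OF FF_has_derivative[OF assms] this]
  have "((\<lambda>y. FF R x y * F_low x y $ j) has_derivative
    (\<lambda>v. (F_low x y \<bullet> v) * F_low x y $ j + FF R x y * ((p x v * covb R x $ j + q x v * covn R x $ j) / SS R x y
        - (p x y * p x v + q x y * q x v) * (p x y * covb R x $ j + q x y * covn R x $ j) / SS R x y ^ 3))) (at y)"
    by (simp add: F_low_def add.commute)
  moreover have "FF R x y * ((p x v * covb R x $ j + q x v * covn R x $ j) / SS R x y
        - (p x y * p x v + q x y * q x v) * (p x y * covb R x $ j + q x y * covn R x $ j) / SS R x y ^ 3)
      = (m_low R x y \<bullet> v) * m_low R x y $ j" for v
  proof -
    define K where "K = sqrt (FF R x y / SS R x y)"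
    have "(m_low R x y \<bullet> v) * m_low R x y $ j = K\<^sup>2 / (SS R x y)\<^sup>2 *
       (p x y * q x v - q x y * p x v) * (p x y * covn R x $ j - q x y * covb R x $ j)"
      by (simp add: m_low_eq[OF assms] K_def[symmetric] inner_simps power2_eq_square)
    also have "K\<^sup>2 = FF R x y / SS R x y"
      using S by (simp add: K_def)
    also have "FF R x y / SS R x y / (SS R x y)\<^sup>2 = FF R x y / SS R x y ^ 3"
      using S by (simp add: power3_eq_cube power2_eq_square)
    also have "FF R x y / SS R x y ^ 3 * (p x y * q x v - q x y * p x v) * (p x y * covn R x $ j - q x y * covb R x $ j) =
      FF R x y / SS R x y ^ 3 * (
       (SS R x y)\<^sup>2 * (p x v * covb R x $ j + q x v * covn R x $ j)
        - (p x y * p x v + q x y * q x v) * (p x y * covb R x $ j + q x y * covn R x $ j))"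
      unfolding SS_power2[OF assms(1)] by algebra
    finally have *: "(m_low R x y \<bullet> v) * m_low R x y $ j = \<dots>" .
    have "FF R x y * (X / SS R x y - Y / SS R x y ^ 3) = FF R x y / SS R x y ^ 3 * ((SS R x y)\<^sup>2 * X - Y)" for X Y
      using S by (simp add: field_simps power3_eq_cube power2_eq_square)
    then show ?thesis unfolding * .
  qed
  ultimately show ?thesis by simp
qed

lemma m_low_inner:
  assumes "x \<in> U" "y \<noteq> 0"
  shows "m_low R x y \<bullet> v = sqrt (FF R x y / SS R x y) / SS R x y * (p x y * q x v - q x y * p x v)"
  by (simp add: m_low_eq[OF assms] inner_simps)

lemma F_low_inner:
  "F_low x y \<bullet> v = (p x y * p x v + q x y * q x v) / SS R x y + c x * p x v"
  by (simp add: F_low_def inner_simps)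

lemma gg_mult:
  assumes "x \<in> U" "y \<noteq> 0"
  shows "gg R x y *v z = (F_low x y \<bullet> z) *\<^sub>R F_low x y + (m_low R x y \<bullet> z) *\<^sub>R m_low R x y"
proof -
  have g: "gg R x y $ i $ j = F_low x y $ i * F_low x y $ j + m_low R x y $ i * m_low R x y $ j" for i j
  proof -
    have "partial j (\<lambda>z. (FF R x z)\<^sup>2) y' = 2 * (FF R x y' * F_low x y' $ j)" if "y' \<noteq> 0" for y'
    proof -
      have "((\<lambda>z. (FF R x z)\<^sup>2) has_derivative (\<lambda>v. 2 * FF R x y' * (F_low x y' \<bullet> v))) (at y')"
        using FF_has_derivative[OF assms(1) that] by (auto intro!: derivative_eq_intros)
      then show ?thesis by (simp add: partial_eq inner_axis)
    qed
    then have "partial i (partial j (\<lambda>z. (FF R x z)\<^sup>2)) y = partial i (\<lambda>y. 2 * (FF R x y * F_low x y $ j)) y"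
      using assms(2) by (intro partial_cong[of "-{0}"]) auto
    also have "\<dots> = 2 * (F_low x y $ i * F_low x y $ j + m_low R x y $ i * m_low R x y $ j)"
      by (subst partial_eq[OF has_derivative_mult_right[OF F_low_has_derivative[OF assms]]])
        (simp add: inner_axis)
    finally show ?thesis by (simp add: gg_def)
  qed
  show ?thesis
    by (simp add: vec_eq_iff matrix_vector_mult_def g inner_2 sum_2 algebra_simps)
qed

text \<open>\<open>m\<^sup>i\<close> in the adapted frame.\<close>

definition m_vec :: "real^2 \<Rightarrow> real^2 \<Rightarrow> real^2" where
  "m_vec x y = (sqrt (SS R x y / FF R x y) / FF R x y) *\<^sub>R
     (- q x y *\<^sub>R e1 x + (c x * SS R x y + p x y) *\<^sub>R e2 x)"

text \<open>This duality carries the whole algebra of the connection: it identifies \<open>m\<^sup>i\<close>, and it evaluates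
  \<open>d\<^sub>n F\<close> and \<open>d\<^sub>n \<theta>\<close>.\<close>

lemma Finsler_frame_dual:
  assumes "x \<in> U" "y \<noteq> 0"
  shows "F_low x y \<bullet> l_up R x y = 1" "m_low R x y \<bullet> m_vec x y = 1"
    "F_low x y \<bullet> m_vec x y = 0" "m_low R x y \<bullet> l_up R x y = 0"
proof -
  have S: "SS R x y > 0" "FF R x y > 0" using assms by (auto intro: SS_pos FF_pos)
  have pm: "p x (m_vec x y) = sqrt (SS R x y / FF R x y) / FF R x y * (- q x y)"
    and qm: "q x (m_vec x y) = sqrt (SS R x y / FF R x y) / FF R x y * (c x * SS R x y + p x y)"
    by (simp_all add: m_vec_def inner_simps frame_dual[OF assms(1)])
  have S2: "SS R x y * SS R x y = p x y * p x y + q x y * q x y"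
    using SS_power2[OF assms(1), of y] by (simp add: power2_eq_square)
  have "F_low x y \<bullet> y = FF R x y"
    using S S2[symmetric] by (simp add: F_low_inner FF_eq)
  then show "F_low x y \<bullet> l_up R x y = 1"
    using S by (simp add: l_up_def)
  show "m_low R x y \<bullet> l_up R x y = 0"
    by (simp add: m_low_inner[OF assms] l_up_def)
  show "F_low x y \<bullet> m_vec x y = 0"
    unfolding F_low_inner pm qm using S by (simp add: field_simps)
  have "sqrt (FF R x y / SS R x y) * sqrt (SS R x y / FF R x y) = 1"
    using S by (simp add: real_sqrt_mult[symmetric])
  then have "m_low R x y \<bullet> m_vec x y = (p x y * (c x * SS R x y + p x y) + q x y * q x y) / (SS R x y * FF R x y)"
    unfolding m_low_inner[OF assms] pm qm using S by (simp add: field_simps)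
  also have "p x y * (c x * SS R x y + p x y) + q x y * q x y = SS R x y * FF R x y"
    using S2 by (simp add: FF_eq algebra_simps)
  finally show "m_low R x y \<bullet> m_vec x y = 1"
    using S by simp
qed

lemma m_up_eq: "x \<in> U \<Longrightarrow> y \<noteq> 0 \<Longrightarrow> m_up R x y = m_vec x y"
  unfolding m_up_def by (rule matrix_inv_dual_frame[OF Finsler_frame_dual gg_mult])

lemma y_low_eq:
  assumes "x \<in> U" "y \<noteq> 0"
  shows "y_low R x y = FF R x y *\<^sub>R F_low x y"
proof -
  have "y = FF R x y *\<^sub>R l_up R x y"
    using FF_pos[OF assms] by (simp add: l_up_def)
  then have "F_low x y \<bullet> y = FF R x y" "m_low R x y \<bullet> y = 0"
    using Finsler_frame_dual[OF assms] by (metis inner_scaleR_right mult.right_neutral, metis inner_scaleR_right mult_zero_right)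
  then show ?thesis by (simp add: y_low_def gg_mult[OF assms])
qed

end

section \<open>Polar angles\<close>

text \<open>The branch of the argument whose cut is the ray opposite to the direction \<open>\<gamma>\<close>, normalised to
  take the value \<open>\<gamma>\<close> on the ray of direction \<open>\<gamma>\<close>.\<close>

definition polar_angle :: "real \<Rightarrow> complex \<Rightarrow> real" where
  "polar_angle \<gamma> z = \<gamma> + Im (Ln (cis (-\<gamma>) * z))"

definition slit :: "real \<Rightarrow> complex set" where
  "slit \<gamma> = {z. cis (-\<gamma>) * z \<notin> \<real>\<^sub>\<le>\<^sub>0}"

lemma open_slit: "open (slit \<gamma>)"
proof -
  have "slit \<gamma> = (\<lambda>z. cis (-\<gamma>) * z) -` (- \<real>\<^sub>\<le>\<^sub>0)" by (auto simp: slit_def)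
  then show ?thesis
    by (auto intro!: open_vimage continuous_intros)
qed

lemma slit_nonzero: "z \<in> slit \<gamma> \<Longrightarrow> z \<noteq> 0"
  by (auto simp: slit_def)

lemma polar_angle_cis:
  assumes "z \<in> slit \<gamma>"
  shows "Re z = cmod z * cos (polar_angle \<gamma> z)" "Im z = cmod z * sin (polar_angle \<gamma> z)"
proof -
  have nz: "z \<noteq> 0" using assms by (rule slit_nonzero)
  then have "cis (-\<gamma>) * z = rcis (cmod z) (polar_angle \<gamma> z - \<gamma>)"
    using rcis_cmod_Arg[of "cis (-\<gamma>) * z"]
    by (simp add: polar_angle_def norm_mult flip: Arg_eq_Im_Ln)
  then have "cis \<gamma> * (cis (-\<gamma>) * z) = cis \<gamma> * rcis (cmod z) (polar_angle \<gamma> z - \<gamma>)"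
    by simp
  then have "z = rcis (cmod z) (polar_angle \<gamma> z)"
    by (simp add: rcis_def cis_mult flip: mult.assoc, simp add: mult.commute[of "cis \<gamma>"] mult.assoc cis_mult)
  then show "Re z = cmod z * cos (polar_angle \<gamma> z)" "Im z = cmod z * sin (polar_angle \<gamma> z)"
    by (metis Re_rcis, metis Im_rcis)
qed

lemma polar_angle_has_derivative:
  assumes f: "(f has_derivative f') (at x within A)" and "f x \<in> slit \<gamma>"
  shows "((\<lambda>u. polar_angle \<gamma> (f u)) has_derivative
     (\<lambda>v. (Re (f x) * Im (f' v) - Im (f x) * Re (f' v)) / (cmod (f x))\<^sup>2)) (at x within A)"
proof -
  have nz: "f x \<noteq> 0" using assms(2) by (rule slit_nonzero)
  have "((\<lambda>u. cis (-\<gamma>) * f u) has_derivative (\<lambda>v. cis (-\<gamma>) * f' v)) (at x within A)"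
    by (intro has_derivative_mult_right f)
  moreover have "(Ln has_derivative (\<lambda>w. inverse (cis (-\<gamma>) * f x) * w)) (at (cis (-\<gamma>) * f x))"
    using has_field_derivative_Ln[of "cis (-\<gamma>) * f x"] assms(2)
    by (simp add: slit_def has_field_derivative_def)
  ultimately have "((\<lambda>u. Ln (cis (-\<gamma>) * f u)) has_derivative
      (\<lambda>v. inverse (cis (-\<gamma>) * f x) * (cis (-\<gamma>) * f' v))) (at x within A)"
    by (rule has_derivative_compose)
  moreover have "inverse (cis (-\<gamma>) * f x) * (cis (-\<gamma>) * f' v) = f' v / f x" for v
    using nz by (simp add: field_simps)
  ultimately have "((\<lambda>u. Ln (cis (-\<gamma>) * f u)) has_derivative (\<lambda>v. f' v / f x)) (at x within A)"
    by simp
  then have "((\<lambda>u. polar_angle \<gamma> (f u)) has_derivative (\<lambda>v. Im (f' v / f x))) (at x within A)"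
    unfolding polar_angle_def by (auto intro!: derivative_eq_intros)
  then show ?thesis
    by (simp add: Im_divide cmod_power2 mult.commute)
qed

lemma continuous_on_polar_angle: "continuous_on (slit \<gamma>) (polar_angle \<gamma>)"
  unfolding polar_angle_def by (intro continuous_intros) (auto simp: slit_def)

lemma cis_2pi_shift: "cis (- (\<gamma> + 2 * pi * of_int k)) = cis (-\<gamma>)"
proof -
  have "cis (-\<gamma>) = cis (- (\<gamma> + 2 * pi * of_int k)) * cis (2 * pi * of_int k)"
    by (simp only: cis_mult) simp
  moreover have "cis (2 * pi * of_int k) = 1"
    by (rule cis_multiple_2pi) simp
  ultimately show ?thesis by (metis mult.right_neutral)
qed

lemma slit_shift: "slit (\<gamma> + 2 * pi * of_int k) = slit \<gamma>"
  unfolding slit_def cis_2pi_shift ..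

lemma polar_angle_shift: "polar_angle (\<gamma> + 2 * pi * of_int k) z = polar_angle \<gamma> z + 2 * pi * of_int k"
  unfolding polar_angle_def cis_2pi_shift by simp

lemma polar_angle_diff:
  assumes "z \<in> slit \<gamma>" "z \<in> slit \<delta>"
  obtains k :: int where "polar_angle \<delta> z = polar_angle \<gamma> z + 2 * pi * of_int k"
proof -
  have "cmod z \<noteq> 0" using slit_nonzero[OF assms(1)] by simp
  then have "cos (polar_angle \<delta> z) = cos (polar_angle \<gamma> z)" "sin (polar_angle \<delta> z) = sin (polar_angle \<gamma> z)"
    using polar_angle_cis[OF assms(1)] polar_angle_cis[OF assms(2)] by (metis mult_cancel_left)+
  then show ?thesis
    using sin_cos_eq_iff that by blast
qed

section \<open>The local form of an angle function\<close>

context randers_surface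
begin

definition zeta :: "real^2 \<Rightarrow> real^2 \<Rightarrow> complex" where
  "zeta x y = Complex (p x y) (q x y)"

lemma cmod_zeta: "x \<in> U \<Longrightarrow> cmod (zeta x y) = SS R x y"
  by (simp add: zeta_def cmod_def SS_eq)

definition angle :: "real \<Rightarrow> real^2 \<Rightarrow> real^2 \<Rightarrow> real" where
  "angle \<gamma> x y = polar_angle \<gamma> (zeta x y)"

lemma zeta_slit_nonzero: "zeta x y \<in> slit \<gamma> \<Longrightarrow> y \<noteq> 0"
  using slit_nonzero by (force simp: zeta_def complex_eq_iff)

lemma angle_cis:
  assumes "x \<in> U" "zeta x y \<in> slit \<gamma>"
  shows "p x y = SS R x y * cos (angle \<gamma> x y)" "q x y = SS R x y * sin (angle \<gamma> x y)"
  using polar_angle_cis[OF assms(2)] assms(1) by (simp_all add: angle_def cmod_zeta) (simp_all add: zeta_def)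

lemma continuous_on_coframe:
  "continuous_on U (bnorm R)" "continuous_on U (covb R)" "continuous_on U (covn R)"
  using randers by (auto simp: randers_on_def intro: smooth_on_continuous)

lemma continuous_on_zeta: "continuous_on (U \<times> UNIV) (\<lambda>(x, y). zeta x y)"
proof -
  have "continuous_on (U \<times> UNIV) (\<lambda>z. covb R (fst z))" "continuous_on (U \<times> UNIV) (\<lambda>z. covn R (fst z))"
    by (rule continuous_on_compose2[OF continuous_on_coframe(2)] continuous_on_compose2[OF continuous_on_coframe(3)];
        auto intro!: continuous_intros)+
  then show ?thesis
    unfolding zeta_def Complex_eq split_beta by (intro continuous_intros)
qed

text \<open>The base points \<open>b(x)\<close> of the angle must move continuously: only then is the normalisation
  \<open>\<theta>(x, b(x)) = 0\<close> available in one fixed neighbourhood of \<open>b(x\<^sub>0)\<close>.\<close>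

lemma continuous_on_b_up: "continuous_on U (b_up R)"
proof -
  let ?D = "\<lambda>x. covb R x $ 1 * covn R x $ 2 - covb R x $ 2 * covn R x $ 1"
  have D: "?D x \<noteq> 0 \<and> b_up R x = (c x / ?D x) *\<^sub>R (covn R x $ 2 *\<^sub>R axis 1 1 - covn R x $ 1 *\<^sub>R axis 2 1)"
    if "x \<in> U" for x
  proof -
    have "?D x * (e1 x $ 1 * e2 x $ 2 - e1 x $ 2 * e2 x $ 1) = p x (e1 x) * q x (e2 x) - p x (e2 x) * q x (e1 x)"
      by (simp add: inner_2 algebra_simps)
    then have D: "?D x \<noteq> 0" using frame_dual[OF that] by auto
    have "?D x * e1 x $ 1 = covn R x $ 2 * p x (e1 x) - covb R x $ 2 * q x (e1 x)"
      "?D x * e1 x $ 2 = covb R x $ 1 * q x (e1 x) - covn R x $ 1 * p x (e1 x)"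
      by (simp_all add: inner_2 algebra_simps)
    then have "e1 x $ 1 = covn R x $ 2 / ?D x" "e1 x $ 2 = - covn R x $ 1 / ?D x"
      using D frame_dual[OF that] by (simp_all add: field_simps)
    then show ?thesis
      using D by (simp add: b_up_eq[OF that] vec_eq_iff forall_2 axis_def)
  qed
  have "continuous_on U (\<lambda>x. (c x / ?D x) *\<^sub>R (covn R x $ 2 *\<^sub>R axis 1 1 - covn R x $ 1 *\<^sub>R axis 2 (1::real)) :: real^2)"
    using D by (intro continuous_intros continuous_on_coframe) auto
  then show ?thesis
    by (rule continuous_on_eq) (use D in simp)
qed

lemma arc_rate_angle:
  assumes "x \<in> U" "zeta x y \<in> slit \<gamma>"
  shows "arc_rate (c x) (angle \<gamma> x y) = sqrt (SS R x y / FF R x y)"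
proof -
  have S: "SS R x y > 0" using SS_pos[OF assms(1) zeta_slit_nonzero[OF assms(2)]] .
  have "FF R x y = SS R x y * (1 + c x * cos (angle \<gamma> x y))"
    using angle_cis(1)[OF assms] by (simp add: FF_eq algebra_simps)
  then have "1 + c x * cos (angle \<gamma> x y) = FF R x y / SS R x y"
    using S by simp
  then show ?thesis by (simp add: arc_rate_def real_sqrt_divide)
qed

lemma angle_has_derivative:
  assumes "x \<in> U" "zeta x y \<in> slit \<gamma>"
  shows "(angle \<gamma> x has_derivative (\<lambda>v. (p x y * q x v - q x y * p x v) / (SS R x y)\<^sup>2)) (at y)"
proof -
  have "(zeta x has_derivative zeta x) (at y)"
    unfolding zeta_def Complex_eq by (auto intro!: derivative_eq_intros)
  from polar_angle_has_derivative[OF this assms(2)]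
  show ?thesis
    unfolding cmod_zeta[OF assms(1)] by (simp add: angle_def[abs_def] zeta_def)
qed

lemma local_theta_has_derivative:
  assumes "x \<in> U" "zeta x y \<in> slit \<gamma>"
  shows "((\<lambda>y. arc_length (c x) (angle \<gamma> x y)) has_derivative (\<lambda>v. (m_low R x y \<bullet> v) / FF R x y)) (at y)"
proof -
  have y: "y \<noteq> 0" using assms(2) by (rule zeta_slit_nonzero)
  have S: "SS R x y > 0" "FF R x y > 0" using assms(1) y by (auto intro: SS_pos FF_pos)
  have "((\<lambda>y. arc_length (c x) (angle \<gamma> x y)) has_derivative
      (\<lambda>v. arc_rate (c x) (angle \<gamma> x y) * ((p x y * q x v - q x y * p x v) / (SS R x y)\<^sup>2))) (at y)"
    using has_derivative_compose[OF angle_has_derivative[OF assms]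
        DERIV_arc_length[OF c_abs[OF assms(1)], unfolded has_field_derivative_def]] .
  moreover have "sqrt (SS R x y / FF R x y) * (X / (SS R x y)\<^sup>2) = sqrt (FF R x y / SS R x y) / SS R x y * X / FF R x y" for X
  proof -
    have "sqrt (SS R x y / FF R x y) * FF R x y = sqrt (FF R x y / SS R x y) * SS R x y"
      using S by (simp add: real_sqrt_divide field_simps)
    then show ?thesis using S by (simp add: field_simps power2_eq_square)
  qed
  ultimately show ?thesis
    unfolding arc_rate_angle[OF assms] m_low_inner[OF assms(1) y] by simp
qed

lemma slit_box:
  assumes "open W" "W \<subseteq> punctured_TM U" "(x, y) \<in> W" "zeta x y \<in> slit \<gamma>"
  obtains A r where "open A" "x \<in> A" "0 < r" "A \<times> ball y r \<subseteq> W"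
    "\<And>x' y'. x' \<in> A \<Longrightarrow> y' \<in> ball y r \<Longrightarrow> x' \<in> U \<and> zeta x' y' \<in> slit \<gamma>"
proof -
  have "open ((U \<times> UNIV) \<inter> (\<lambda>(x, y). zeta x y) -` slit \<gamma>)"
    by (intro continuous_open_preimage continuous_on_zeta open_slit open_Times open_U open_UNIV)
  then have "open (W \<inter> ((U \<times> UNIV) \<inter> (\<lambda>(x, y). zeta x y) -` slit \<gamma>))"
    using assms(1) by blast
  moreover have "(x, y) \<in> W \<inter> ((U \<times> UNIV) \<inter> (\<lambda>(x, y). zeta x y) -` slit \<gamma>)"
    using assms by (auto simp: punctured_TM_def)
  ultimately obtain A B where AB: "open A" "open B" "(x, y) \<in> A \<times> B"
    "A \<times> B \<subseteq> W \<inter> ((U \<times> UNIV) \<inter> (\<lambda>(x, y). zeta x y) -` slit \<gamma>)"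
    by (rule open_prod_elim)
  then obtain r where r: "0 < r" "ball y r \<subseteq> B"
    using open_contains_ball by (metis mem_Sigma_iff)
  have *: "A \<times> ball y r \<subseteq> W \<inter> ((U \<times> UNIV) \<inter> (\<lambda>(x, y). zeta x y) -` slit \<gamma>)"
    using AB(4) r(2) by blast
  show ?thesis
  proof (rule that[of A r])
    show "x' \<in> U \<and> zeta x' y' \<in> slit \<gamma>" if "x' \<in> A" "y' \<in> ball y r" for x' y'
      using subsetD[OF *, of "(x', y')"] that by simp
  qed (use AB r * in auto)
qed

lemma angle_function_has_derivative:
  assumes "angle_function U R W \<theta>" "(x, y) \<in> W"
  shows "(\<theta> x has_derivative (\<lambda>v. (m_low R x y \<bullet> v) / FF R x y)) (at y)"
proof -
  have "(x, y) \<in> punctured_TM U" using assms by (auto simp: angle_function_def)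
  then have F: "FF R x y > 0" by (intro FF_pos) (auto simp: punctured_TM_def)
  have "\<theta> x differentiable (at y)" and m: "\<And>i. FF R x y * partial i (\<theta> x) y = m_low R x y $ i"
    using assms by (auto simp: angle_function_def)
  then have d: "(\<theta> x has_derivative frechet_derivative (\<theta> x) (at y)) (at y)"
    by (simp add: frechet_derivative_works)
  have "frechet_derivative (\<theta> x) (at y) v = (m_low R x y \<bullet> v) / FF R x y" for v
  proof -
    interpret linear "frechet_derivative (\<theta> x) (at y)" using d by (rule has_derivative_linear)
    have "v = v $ 1 *\<^sub>R axis 1 1 + v $ 2 *\<^sub>R axis 2 1"
      by (simp add: vec_eq_iff forall_2 axis_def)
    then have "frechet_derivative (\<theta> x) (at y) v = v $ 1 * partial 1 (\<theta> x) y + v $ 2 * partial 2 (\<theta> x) y"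
      unfolding partial_eq[OF d] by (metis add scale real_scaleR_def)
    then show ?thesis
      using F by (simp add: inner_2 flip: m) (simp add: field_simps)
  qed
  then have "frechet_derivative (\<theta> x) (at y) = (\<lambda>v. (m_low R x y \<bullet> v) / FF R x y)" by blast
  then show ?thesis using d by simp
qed

text \<open>On a ball in a fibre, the angle function and the arc length have the same differential, so
  they agree as soon as they agree at one point.\<close>

lemma local_theta_unique:
  assumes "angle_function U R W \<theta>" "x \<in> U"
    and B: "\<And>y'. y' \<in> ball y r \<Longrightarrow> (x, y') \<in> W \<and> zeta x y' \<in> slit \<gamma>"
    and y1: "y1 \<in> ball y r" "\<theta> x y1 = arc_length (c x) (angle \<gamma> x y1)"
    and y2: "y2 \<in> ball y r"
  shows "\<theta> x y2 = arc_length (c x) (angle \<gamma> x y2)"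
proof -
  have "((\<lambda>y. \<theta> x y - arc_length (c x) (angle \<gamma> x y)) has_derivative (\<lambda>h. 0)) (at y' within ball y r)"
    if "y' \<in> ball y r" for y'
    using has_derivative_diff[OF angle_function_has_derivative[OF assms(1), of x y']
        local_theta_has_derivative[OF assms(2), of y' \<gamma>]] B[OF that]
    by (auto intro: has_derivative_at_withinI)
  then obtain k where k: "\<And>y'. y' \<in> ball y r \<Longrightarrow> \<theta> x y' - arc_length (c x) (angle \<gamma> x y') = k"
    using has_derivative_zero_constant[OF convex_ball, of y r "\<lambda>y. \<theta> x y - arc_length (c x) (angle \<gamma> x y)"] by metis
  then show ?thesis using k[OF y1(1)] k[OF y2] y1(2) by simp
qed

text \<open>One branch \<open>\<gamma>\<close> has to serve a whole neighbourhood in \<open>x\<close> and \<open>y\<close>, since the formula will be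
  differentiated in both variables.\<close>

definition locally_arc_length ::
  "((real^2) \<times> (real^2)) set \<Rightarrow> (real^2 \<Rightarrow> real^2 \<Rightarrow> real) \<Rightarrow> real^2 \<Rightarrow> real^2 \<Rightarrow> bool" where
  "locally_arc_length W \<theta> x y \<longleftrightarrow> (\<exists>\<gamma> A B. open A \<and> open B \<and> x \<in> A \<and> y \<in> B \<and> A \<times> B \<subseteq> W \<and>
     (\<forall>x'\<in>A. \<forall>y'\<in>B. zeta x' y' \<in> slit \<gamma> \<and> \<theta> x' y' = arc_length (c x') (angle \<gamma> x' y')))"

lemma locally_arc_length_b_up:
  assumes \<theta>: "angle_function U R W \<theta>" and x: "x \<in> U"
  shows "locally_arc_length W \<theta> x (b_up R x)"
proof -
  have W: "open W" "W \<subseteq> punctured_TM U" "(x, b_up R x) \<in> W"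
    using \<theta> x by (auto simp: angle_function_def fib_def)
  have z: "zeta x' (b_up R x') = of_real (c x')" if "x' \<in> U" for x'
    using frame_dual[OF that] by (simp add: zeta_def b_up_eq[OF that] complex_eq_iff)
  have "zeta x (b_up R x) \<in> slit 0"
    using c_bounds[OF x] by (simp add: z[OF x] slit_def)
  from slit_box[OF W this] obtain A r where A: "open A" "x \<in> A" "0 < r" "A \<times> ball (b_up R x) r \<subseteq> W"
    "\<And>x' y'. x' \<in> A \<Longrightarrow> y' \<in> ball (b_up R x) r \<Longrightarrow> x' \<in> U \<and> zeta x' y' \<in> slit 0" by blast
  define A' where "A' = A \<inter> (U \<inter> b_up R -` ball (b_up R x) r)"
  have "open A'" unfolding A'_def
    by (intro open_Int A continuous_open_preimage continuous_on_b_up open_U open_ball)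
  moreover have "\<theta> x' y' = arc_length (c x') (angle 0 x' y')" if "x' \<in> A'" "y' \<in> ball (b_up R x) r" for x' y'
  proof (rule local_theta_unique[OF \<theta>])
    show "x' \<in> U" and "b_up R x' \<in> ball (b_up R x) r" using that by (auto simp: A'_def)
    show "(x', y') \<in> W \<and> zeta x' y' \<in> slit 0" if "y' \<in> ball (b_up R x) r" for y'
      using that \<open>x' \<in> A'\<close> A by (auto simp: A'_def)
    have "\<theta> x' (b_up R x') = 0" using \<theta> \<open>x' \<in> U\<close> by (simp add: angle_function_def)
    moreover have "angle 0 x' (b_up R x') = 0"
      using c_bounds[OF \<open>x' \<in> U\<close>] by (simp add: angle_def z[OF \<open>x' \<in> U\<close>] polar_angle_def Im_Ln_eq_0)
    ultimately show "\<theta> x' (b_up R x') = arc_length (c x') (angle 0 x' (b_up R x'))"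
      by (simp add: arc_length_def)
  qed (use that in auto)
  ultimately show ?thesis
    unfolding locally_arc_length_def using A x
    by (intro exI[of _ 0] exI[of _ A'] exI[of _ "ball (b_up R x) r"]) (auto simp: A'_def)
qed

text \<open>A branch that is correct near \<open>(x, y1)\<close> agrees there with a suitable shift by \<open>2\<pi>k\<close> of the branch
  centred at \<open>y\<close>: the difference is continuous in the base point, vanishes at \<open>x\<close>, and takes values in
  \<open>2\<pi>\<int>\<close>.  Uniqueness in each fibre then extends the agreement to the whole ball.\<close>

lemma locally_arc_length_transfer:
  assumes \<theta>: "angle_function U R W \<theta>" and y: "(x, y) \<in> W"
  obtains r where "0 < r" "\<And>y'. y' \<in> ball y r \<Longrightarrow> (x, y') \<in> W"
    "\<And>y1 y2. y1 \<in> ball y r \<Longrightarrow> y2 \<in> ball y r \<Longrightarrow>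
       locally_arc_length W \<theta> x y1 \<Longrightarrow> locally_arc_length W \<theta> x y2"
proof -
  have W: "open W" "W \<subseteq> punctured_TM U"
    using \<theta> by (auto simp: angle_function_def)
  then have x: "x \<in> U" and "y \<noteq> 0" using y by (auto simp: punctured_TM_def)
  define \<gamma> where "\<gamma> = Arg (zeta x y)"
  have "zeta x y = rcis (SS R x y) \<gamma>"
    using rcis_cmod_Arg[of "zeta x y"] by (simp add: \<gamma>_def cmod_zeta[OF x])
  then have "cis (-\<gamma>) * zeta x y = of_real (SS R x y)"
    by (simp add: rcis_def mult.left_commute cis_mult)
  then have "zeta x y \<in> slit \<gamma>"
    using SS_pos[OF x \<open>y \<noteq> 0\<close>] by (simp add: slit_def)
  from slit_box[OF W y this] obtain A r where A: "open A" "x \<in> A" "0 < r" "A \<times> ball y r \<subseteq> W"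
    "\<And>x' y'. x' \<in> A \<Longrightarrow> y' \<in> ball y r \<Longrightarrow> x' \<in> U \<and> zeta x' y' \<in> slit \<gamma>" by blast
  show ?thesis
  proof (rule that[OF A(3)])
    show "(x, y') \<in> W" if "y' \<in> ball y r" for y' using A that by auto
    fix y1 y2 assume y12: "y1 \<in> ball y r" "y2 \<in> ball y r" and "locally_arc_length W \<theta> x y1"
    then obtain \<delta> A1 B1 where 1: "open A1" "x \<in> A1" "y1 \<in> B1"
      "\<And>x' y'. x' \<in> A1 \<Longrightarrow> y' \<in> B1 \<Longrightarrow> zeta x' y' \<in> slit \<delta> \<and> \<theta> x' y' = arc_length (c x') (angle \<delta> x' y')"
      unfolding locally_arc_length_def by metis
    have "zeta x y1 \<in> slit \<gamma>" "zeta x y1 \<in> slit \<delta>" using A 1 y12 by auto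
    then obtain k where k: "polar_angle \<delta> (zeta x y1) = polar_angle \<gamma> (zeta x y1) + 2 * pi * of_int k"
      by (rule polar_angle_diff)
    define \<epsilon> where "\<epsilon> = \<gamma> + 2 * pi * of_int k"
    have sl: "slit \<epsilon> = slit \<gamma>" by (simp add: \<epsilon>_def slit_shift)
    have 0: "angle \<epsilon> x y1 = angle \<delta> x y1" by (simp add: angle_def \<epsilon>_def polar_angle_shift k)
    let ?d = "\<lambda>x'. angle \<epsilon> x' y1 - angle \<delta> x' y1"
    have AU: "A \<subseteq> U" using A(5)[OF _ y12(1)] by blast
    have zc: "continuous_on (A \<inter> A1) (\<lambda>x'. zeta x' y1)"
      by (rule continuous_on_compose2[OF continuous_on_zeta, of "A \<inter> A1" "\<lambda>x'. (x', y1)", simplified])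
        (use AU in \<open>auto intro!: continuous_intros\<close>)
    have "continuous_on (A \<inter> A1) ?d" unfolding angle_def
      by (intro continuous_on_diff continuous_on_compose2[OF continuous_on_polar_angle zc])
        (use A 1 y12 sl in auto)
    then have op: "open ((A \<inter> A1) \<inter> ?d -` ball 0 (2 * pi))"
      using A 1 by (intro continuous_open_preimage) auto
    define A' where "A' = (A \<inter> A1) \<inter> ?d -` ball 0 (2 * pi)"
    have "x \<in> A'" using A 1 0 by (simp add: A'_def)
    have eq: "angle \<epsilon> x' y1 = angle \<delta> x' y1" if "x' \<in> A'" for x'
    proof -
      have "zeta x' y1 \<in> slit \<delta>" "zeta x' y1 \<in> slit \<epsilon>" using that A 1 y12 sl by (auto simp: A'_def)
      then obtain j where j: "polar_angle \<epsilon> (zeta x' y1) = polar_angle \<delta> (zeta x' y1) + 2 * pi * of_int j"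
        by (rule polar_angle_diff)
      then have "?d x' = 2 * pi * of_int j" by (simp add: angle_def)
      moreover have "\<bar>?d x'\<bar> < 2 * pi" using that by (simp add: A'_def)
      ultimately have "2 * pi * \<bar>real_of_int j\<bar> < 2 * pi * 1" by (simp add: abs_mult)
      then have "j = 0" by (subst (asm) mult_less_cancel_left_pos) auto
      then show ?thesis using j by (simp add: angle_def)
    qed
    have "\<theta> x' y' = arc_length (c x') (angle \<epsilon> x' y')" if "x' \<in> A'" "y' \<in> ball y r" for x' y'
    proof (rule local_theta_unique[OF \<theta> _ _ y12(1) _ that(2)])
      show "x' \<in> U" using that A by (auto simp: A'_def)
      show "(x', z) \<in> W \<and> zeta x' z \<in> slit \<epsilon>" if "z \<in> ball y r" for z
        using that \<open>x' \<in> A'\<close> A sl by (auto simp: A'_def)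
      show "\<theta> x' y1 = arc_length (c x') (angle \<epsilon> x' y1)"
        using eq[OF that(1)] that(1) 1 by (auto simp: A'_def)
    qed
    then show "locally_arc_length W \<theta> x y2"
      unfolding locally_arc_length_def using A op y12 \<open>x \<in> A'\<close> sl
      by (intro exI[of _ \<epsilon>] exI[of _ A'] exI[of _ "ball y r"]) (auto simp: A'_def)
  qed
qed

lemma angle_function_local_form:
  assumes \<theta>: "angle_function U R W \<theta>" and y: "(x, y) \<in> W"
  shows "locally_arc_length W \<theta> x y"
proof -
  have x: "x \<in> U" using \<theta> y by (auto simp: angle_function_def punctured_TM_def)
  have "connected (fib W x)" "b_up R x \<in> fib W x" using \<theta> x by (auto simp: angle_function_def)
  then show ?thesis
  proof (rule connected_induction_simple)
    show "y \<in> fib W x" using y by (simp add: fib_def)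
    show "locally_arc_length W \<theta> x (b_up R x)" by (rule locally_arc_length_b_up[OF \<theta> x])
    fix a assume "a \<in> fib W x"
    then have "(x, a) \<in> W" by (simp add: fib_def)
    from locally_arc_length_transfer[OF \<theta> this] obtain r where r: "0 < r" "\<And>y'. y' \<in> ball a r \<Longrightarrow> (x, y') \<in> W"
      "\<And>y1 y2. y1 \<in> ball a r \<Longrightarrow> y2 \<in> ball a r \<Longrightarrow>
       locally_arc_length W \<theta> x y1 \<Longrightarrow> locally_arc_length W \<theta> x y2" by blast
    have "openin (top_of_set (fib W x)) (ball a r)"
      using r(2) by (intro open_subset) (auto simp: fib_def)
    moreover have "a \<in> ball a r" using r(1) by simp
    ultimately show "\<exists>T. openin (top_of_set (fib W x)) T \<and> a \<in> T \<and>
        (\<forall>y1\<in>T. \<forall>y2\<in>T. locally_arc_length W \<theta> x y1 \<longrightarrow> locally_arc_length W \<theta> x y2)"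
      using r(3) by (intro exI[of _ "ball a r"]) blast
  qed
qed

section \<open>Derivatives along the base\<close>

definition dc :: "real^2 \<Rightarrow> 2 \<Rightarrow> real" where
  "dc x n = frechet_derivative (bnorm R) (at x) (axis n 1)"

text \<open>At a fixed tangent vector \<open>y\<close>, moving the base point changes \<open>(p, q)\<close>; \<open>shift\<close> is the tangent vector
  having that velocity as its coframe components.  It is linear in \<open>y\<close>.\<close>

definition shift :: "real^2 \<Rightarrow> 2 \<Rightarrow> real^2 \<Rightarrow> real^2" where
  "shift x n y = (frechet_derivative (covb R) (at x) (axis n 1) \<bullet> y) *\<^sub>R e1 x
     + (frechet_derivative (covn R) (at x) (axis n 1) \<bullet> y) *\<^sub>R e2 x"

lemma coframe_shift:
  assumes "x \<in> U"
  shows "p x (shift x n y) = frechet_derivative (covb R) (at x) (axis n 1) \<bullet> y"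
    "q x (shift x n y) = frechet_derivative (covn R) (at x) (axis n 1) \<bullet> y"
  using frame_dual[OF assms] by (simp_all add: shift_def inner_simps)

lemma coframe_has_derivative:
  assumes "x \<in> U"
  shows "(bnorm R has_derivative frechet_derivative (bnorm R) (at x)) (at x)"
    "((\<lambda>u. p u y) has_derivative (\<lambda>t. frechet_derivative (covb R) (at x) t \<bullet> y)) (at x)"
    "((\<lambda>u. q u y) has_derivative (\<lambda>t. frechet_derivative (covn R) (at x) t \<bullet> y)) (at x)"
  using randers assms
  by (auto simp: randers_on_def intro!: smooth_on_derivative has_derivative_inner_left)

lemma FF_base_derivative:
  assumes "x \<in> U" "y \<noteq> 0"
  shows "(\<lambda>u. FF R u y) differentiable (at x)"
    "partial n (\<lambda>u. FF R u y) x = F_low x y \<bullet> shift x n y + dc x n * p x y"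
proof -
  let ?b = "\<lambda>t. frechet_derivative (covb R) (at x) t \<bullet> y"
  let ?n = "\<lambda>t. frechet_derivative (covn R) (at x) t \<bullet> y"
  let ?c = "frechet_derivative (bnorm R) (at x)"
  have "((\<lambda>u. (p u y)\<^sup>2 + (q u y)\<^sup>2) has_derivative (\<lambda>t. 2 * (p x y * ?b t + q x y * ?n t))) (at x)"
    by (rule derivative_eq_intros coframe_has_derivative[OF assms(1)] refl)+ (simp add: algebra_simps)
  from has_derivative_compose[OF this DERIV_real_sqrt[OF coframe_norm_pos[OF assms], unfolded has_field_derivative_def]]
  have "((\<lambda>u. sqrt ((p u y)\<^sup>2 + (q u y)\<^sup>2)) has_derivative
     (\<lambda>t. (p x y * ?b t + q x y * ?n t) / SS R x y)) (at x)"
    by (simp add: inverse_eq_divide SS_eq[OF assms(1)] del: distrib_left_numeral)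
  from has_derivative_add[OF this has_derivative_mult[OF coframe_has_derivative(1,2)[OF assms(1)], of y]]
  have d: "((\<lambda>u. sqrt ((p u y)\<^sup>2 + (q u y)\<^sup>2) + c u * p u y) has_derivative
     (\<lambda>t. (p x y * ?b t + q x y * ?n t) / SS R x y + (c x * ?b t + ?c t * p x y))) (at x)"
    by simp
  have d: "((\<lambda>u. FF R u y) has_derivative
     (\<lambda>t. (p x y * ?b t + q x y * ?n t) / SS R x y + (c x * ?b t + ?c t * p x y))) (at x)"
    by (rule has_derivative_transform_within_open[OF d open_U assms(1)]) (simp add: FF_eq SS_eq)
  then show "(\<lambda>u. FF R u y) differentiable (at x)" by (auto simp: differentiable_def)
  show "partial n (\<lambda>u. FF R u y) x = F_low x y \<bullet> shift x n y + dc x n * p x y"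
    by (simp add: partial_eq[OF d] F_low_inner coframe_shift[OF assms(1)] dc_def)
qed

lemma shift_smooth [smooth]:
  assumes "open S" "x \<in> U"
  shows "smooth_on S (\<lambda>y. p x (shift x n y))" "smooth_on S (\<lambda>y. q x (shift x n y))"
  unfolding coframe_shift[OF assms(2)] by (intro smooth assms)+

lemma F_low_shift_smooth:
  assumes "x \<in> U"
  shows "smooth_on (-{0}) (\<lambda>y. F_low x y \<bullet> shift x n y)"
  unfolding F_low_inner by (intro smooth assms) (use assms SS_pos in auto)

lemma FF_base_derivative_smooth:
  assumes "x \<in> U"
  shows "smooth_on (-{0}) (\<lambda>y. partial n (\<lambda>u. FF R u y) x)"
  by (rule smooth_on_cong[where f = "\<lambda>y. F_low x y \<bullet> shift x n y + dc x n * p x y"])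
    (use assms in \<open>auto intro!: smooth F_low_shift_smooth simp: FF_base_derivative\<close>)

lemma local_theta_base_derivative:
  assumes x: "x \<in> U" and "zeta x y \<in> slit \<gamma>"
  shows "(\<lambda>u. arc_length (c u) (angle \<gamma> u y)) differentiable (at x)"
    "partial n (\<lambda>u. arc_length (c u) (angle \<gamma> u y)) x =
       dc x n * arc_length_deriv (c x) (angle \<gamma> x y) + (m_low R x y \<bullet> shift x n y) / FF R x y"
proof -
  let ?b = "\<lambda>t. frechet_derivative (covb R) (at x) t \<bullet> y"
  let ?n = "\<lambda>t. frechet_derivative (covn R) (at x) t \<bullet> y"
  let ?c = "frechet_derivative (bnorm R) (at x)"
  have y: "y \<noteq> 0" using assms(2) by (rule zeta_slit_nonzero)
  have S: "SS R x y > 0" "FF R x y > 0" using x y by (auto intro: SS_pos FF_pos)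
  have "((\<lambda>u. zeta u y) has_derivative (\<lambda>t. Complex (?b t) (?n t))) (at x)"
    unfolding zeta_def Complex_eq
    by (rule derivative_eq_intros coframe_has_derivative[OF x] refl)+ simp
  from polar_angle_has_derivative[OF this assms(2)]
  have a: "((\<lambda>u. angle \<gamma> u y) has_derivative (\<lambda>t. (p x y * ?n t - q x y * ?b t) / (SS R x y)\<^sup>2)) (at x)"
    unfolding cmod_zeta[OF x] by (simp add: angle_def zeta_def)
  have "((\<lambda>u. (c u, angle \<gamma> u y)) has_derivative
      (\<lambda>t. (?c t, (p x y * ?n t - q x y * ?b t) / (SS R x y)\<^sup>2))) (at x)"
    by (intro has_derivative_Pair a coframe_has_derivative x)
  from has_derivative_compose[OF this arc_length_has_derivative[OF c_abs[OF x]]]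
  have d: "((\<lambda>u. arc_length (c u) (angle \<gamma> u y)) has_derivative
     (\<lambda>t. arc_length_deriv (c x) (angle \<gamma> x y) * ?c t
        + arc_rate (c x) (angle \<gamma> x y) * ((p x y * ?n t - q x y * ?b t) / (SS R x y)\<^sup>2))) (at x)"
    by simp
  then show "(\<lambda>u. arc_length (c u) (angle \<gamma> u y)) differentiable (at x)"
    by (auto simp: differentiable_def)
  have "arc_rate (c x) (angle \<gamma> x y) * ((p x y * q x v - q x y * p x v) / (SS R x y)\<^sup>2) = (m_low R x y \<bullet> v) / FF R x y" for v
  proof -
    have "((\<lambda>y. arc_length (c x) (angle \<gamma> x y)) has_derivative
      (\<lambda>v. arc_rate (c x) (angle \<gamma> x y) * ((p x y * q x v - q x y * p x v) / (SS R x y)\<^sup>2))) (at y)"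
      using has_derivative_compose[OF angle_has_derivative[OF assms]
          DERIV_arc_length[OF c_abs[OF x], unfolded has_field_derivative_def]] .
    from has_derivative_unique[OF this local_theta_has_derivative[OF assms]] show ?thesis by metis
  qed
  then show "partial n (\<lambda>u. arc_length (c u) (angle \<gamma> u y)) x =
       dc x n * arc_length_deriv (c x) (angle \<gamma> x y) + (m_low R x y \<bullet> shift x n y) / FF R x y"
    unfolding partial_eq[OF d] coframe_shift[OF x, symmetric] by (simp add: dc_def)
qed

lemma theta_base_derivative:
  assumes \<theta>: "angle_function U R W \<theta>" and y: "(x, y) \<in> W"
  obtains \<gamma> B where "open B" "y \<in> B" "B \<subseteq> fib W x"
    "\<And>y. y \<in> B \<Longrightarrow> zeta x y \<in> slit \<gamma>"
    "\<And>y. y \<in> B \<Longrightarrow> (\<lambda>u. \<theta> u y) differentiable (at x)"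
    "\<And>y n. y \<in> B \<Longrightarrow> partial n (\<lambda>u. \<theta> u y) x =
       dc x n * arc_length_deriv (c x) (angle \<gamma> x y) + (m_low R x y \<bullet> shift x n y) / FF R x y"
proof -
  have x: "x \<in> U" using \<theta> y by (auto simp: angle_function_def punctured_TM_def)
  obtain \<gamma> A B where AB: "open A" "open B" "x \<in> A" "y \<in> B" "A \<times> B \<subseteq> W"
    and eq: "\<And>x' y'. x' \<in> A \<Longrightarrow> y' \<in> B \<Longrightarrow> zeta x' y' \<in> slit \<gamma> \<and> \<theta> x' y' = arc_length (c x') (angle \<gamma> x' y')"
    using angle_function_local_form[OF \<theta> y] unfolding locally_arc_length_def by metis
  show ?thesis
  proof (rule that[OF AB(2,4), of \<gamma>])
    show "B \<subseteq> fib W x" using AB by (auto simp: fib_def)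
    fix y assume "y \<in> B"
    then show z: "zeta x y \<in> slit \<gamma>" using eq AB by blast
    show "(\<lambda>u. \<theta> u y) differentiable (at x)"
    proof -
      obtain D where "((\<lambda>u. arc_length (c u) (angle \<gamma> u y)) has_derivative D) (at x)"
        using local_theta_base_derivative(1)[OF x z] by (auto simp: differentiable_def)
      then have "((\<lambda>u. \<theta> u y) has_derivative D) (at x)"
        by (rule has_derivative_transform_within_open[OF _ AB(1,3)]) (use eq \<open>y \<in> B\<close> in simp)
      then show ?thesis by (auto simp: differentiable_def)
    qed
    fix n
    show "partial n (\<lambda>u. \<theta> u y) x =
       dc x n * arc_length_deriv (c x) (angle \<gamma> x y) + (m_low R x y \<bullet> shift x n y) / FF R x y"
      unfolding local_theta_base_derivative(2)[OF x z, symmetric]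
      using AB eq \<open>y \<in> B\<close> by (intro partial_cong[of A]) auto
  qed
qed

lemma open_fib:
  assumes "angle_function U R W \<theta>"
  shows "open (fib W x)"
proof -
  have "fib W x = Pair x -` W" by (auto simp: fib_def)
  then show ?thesis using assms
    by (auto simp: angle_function_def intro!: open_vimage continuous_intros)
qed

lemma fib_subset:
  assumes "angle_function U R W \<theta>"
  shows "fib W x \<subseteq> - {0}"
  using assms by (auto simp: angle_function_def fib_def punctured_TM_def)

text \<open>The non-elementary part \<open>\<partial>c/\<partial>x\<^sup>n \<partial>G/\<partial>c\<close> depends on a branch of the angle that exists only locally, but
  its differential does not; so smoothness on the whole fibre follows from \<open>smooth_onI_derivative\<close>.\<close>

lemma theta_base_derivative_smooth:
  assumes \<theta>: "angle_function U R W \<theta>" and x: "x \<in> U"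
  shows "smooth_on (fib W x) (\<lambda>y. partial n (\<lambda>u. \<theta> u y) x)"
proof -
  \<comment> \<open>the algebraic part of \<open>?H\<close>; \<open>?d\<close> is the differential of the remaining part\<close>
  let ?T = "\<lambda>y. (m_low R x y \<bullet> shift x n y) / FF R x y"
  let ?H = "\<lambda>y. partial n (\<lambda>u. \<theta> u y) x"
  let ?K = "\<lambda>y. dc x n * (- (1/2) * (p x y / SS R x y) * sqrt (SS R x y / FF R x y) ^ 3)"
  let ?d = "\<lambda>y v. ?K y * ((p x y * q x v - q x y * p x v) / (SS R x y)\<^sup>2)"
  have op: "open (fib W x)" using \<theta> by (rule open_fib)
  have S: "SS R x y > 0" "FF R x y > 0" if "y \<in> - {0}" for y
    using that x by (auto intro: SS_pos FF_pos)
  have "smooth_on (- {0}) (\<lambda>y. sqrt (FF R x y / SS R x y) / SS R x y *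
      (p x y * q x (shift x n y) - q x y * p x (shift x n y)) / FF R x y)"
    by (intro smooth x open_Compl closed_singleton S) (auto simp: S)
  then have "smooth_on (- {0}) ?T"
    by (rule smooth_on_cong[rotated]) (auto simp: m_low_inner x)
  then have T: "smooth_on (fib W x) ?T"
    using fib_subset[OF \<theta>] by (rule smooth_on_subset)
  have "((\<lambda>y. ?H y - ?T y) has_derivative ?d y) (at y)" if "y \<in> fib W x" for y
  proof -
    have "(x, y) \<in> W" using that by (simp add: fib_def)
    from theta_base_derivative[OF \<theta> this] obtain \<gamma> B where B: "open B" "y \<in> B"
      "\<And>y. y \<in> B \<Longrightarrow> zeta x y \<in> slit \<gamma>"
      "\<And>y n. y \<in> B \<Longrightarrow> partial n (\<lambda>u. \<theta> u y) x =
       dc x n * arc_length_deriv (c x) (angle \<gamma> x y) + (m_low R x y \<bullet> shift x n y) / FF R x y" by metis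
    have "cos (angle \<gamma> x y) = p x y / SS R x y"
      using angle_cis(1)[OF x B(3)[OF B(2)]] SS_pos[OF x zeta_slit_nonzero[OF B(3)[OF B(2)]]] by simp
    with has_derivative_compose[OF angle_has_derivative[OF x B(3)[OF B(2)]]
        DERIV_arc_length_deriv[OF c_abs[OF x], unfolded has_field_derivative_def]]
    have "((\<lambda>y. dc x n * arc_length_deriv (c x) (angle \<gamma> x y)) has_derivative ?d y) (at y)"
      unfolding arc_rate_angle[OF x B(3)[OF B(2)]]
      by (auto dest: has_derivative_mult_right[where x = "dc x n"] simp: mult.assoc)
    then show ?thesis
      by (rule has_derivative_transform_within_open[OF _ B(1,2)]) (simp add: B(4))
  qed
  moreover have "smooth_on (fib W x) (\<lambda>y. ?d y v)" for v
  proof (rule smooth_on_subset[OF _ fib_subset[OF \<theta>]])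
    show "smooth_on (- {0}) (\<lambda>y. ?d y v)"
      by (intro smooth x open_Compl closed_singleton S) (use S in force)+
  qed
  ultimately have "smooth_on (fib W x) (\<lambda>y. ?H y - ?T y)"
    by (rule smooth_onI_derivative[OF op])
  from smooth_on_add[OF op this T] show ?thesis by simp
qed

lemma m_vec_smooth:
  assumes "x \<in> U"
  shows "smooth_on (- {0}) (\<lambda>y. m_vec x y $ k)"
proof -
  have S: "SS R x y > 0" "FF R x y > 0" if "y \<in> - {0}" for y
    using that assms by (auto intro: SS_pos FF_pos)
  show ?thesis
    unfolding m_vec_def vector_scaleR_component vector_add_component real_scaleR_def
    by (intro smooth assms open_Compl closed_singleton S) (auto simp: S)
qed

lemma N_coeff_smooth:
  assumes \<theta>: "angle_function U R W \<theta>" and x: "x \<in> U"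
  shows "smooth_on (fib W x) (N_coeff R \<theta> kf k n x)"
proof -
  have op: "open (fib W x)" using \<theta> by (rule open_fib)
  have sub: "smooth_on (- {0}) f \<Longrightarrow> smooth_on (fib W x) f" for f :: "real^2 \<Rightarrow> real"
    using fib_subset[OF \<theta>] by (rule smooth_on_subset[rotated])
  have nz: "y \<noteq> 0" if "y \<in> fib W x" for y using that fib_subset[OF \<theta>] by auto
  have "smooth_on (fib W x) (\<lambda>y. - (y $ k / FF R x y) * partial n (\<lambda>u. FF R u y) x
     - FF R x y * m_vec x y $ k * (partial n (\<lambda>u. \<theta> u y) x - kf x $ n))"
    by (intro smooth op sub[OF FF_smooth] sub[OF m_vec_smooth] sub[OF FF_base_derivative_smooth]
        theta_base_derivative_smooth \<theta> x) (use x nz FF_pos in auto)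
  then show ?thesis
    by (rule smooth_on_cong[OF op]) (use x nz in \<open>auto simp: N_coeff_def l_up_def m_up_eq\<close>)
qed

section \<open>The connection\<close>

text \<open>In polar coordinates, the Hessian of \<open>S V(\<psi>)\<close> is \<open>S (V + V'') d\<psi> d\<psi>\<close>; a linear summand does not
  affect it.\<close>

lemma hessian_polar:
  assumes x: "x \<in> U" and B: "open B" "y \<in> B" "\<And>z. z \<in> B \<Longrightarrow> zeta x z \<in> slit \<gamma>"
    and L: "bounded_linear L"
    and V: "\<And>s. (V has_real_derivative V' s) (at s)" "\<And>s. (V' has_real_derivative V'' s) (at s)"
    and f: "\<And>z. z \<in> B \<Longrightarrow> f z = L z + SS R x z * V (angle \<gamma> x z)"
  shows "partial m (partial i f) y =
     (cos (angle \<gamma> x y) * covn R x $ i - sin (angle \<gamma> x y) * covb R x $ i)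
       * ((p x y * covn R x $ m - q x y * covb R x $ m) / (SS R x y)\<^sup>2)
       * (V (angle \<gamma> x y) + V'' (angle \<gamma> x y))"
proof -
  let ?b = "covb R x $ i" and ?n = "covn R x $ i"
  have S: "SS R x z > 0" if "z \<in> B" for z
    using SS_pos[OF x zeta_slit_nonzero[OF B(3)[OF that]]] .
  let ?g = "\<lambda>z. L (axis i 1) + ((cos (angle \<gamma> x z) * ?b + sin (angle \<gamma> x z) * ?n) * V (angle \<gamma> x z)
      + (cos (angle \<gamma> x z) * ?n - sin (angle \<gamma> x z) * ?b) * V' (angle \<gamma> x z))"
  have "partial i f z = ?g z" if z: "z \<in> B" for z
  proof -
    let ?\<psi> = "angle \<gamma> x z"
    have "((\<lambda>z. V (angle \<gamma> x z)) has_derivative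
        (\<lambda>v. V' ?\<psi> * ((p x z * q x v - q x z * p x v) / (SS R x z)\<^sup>2))) (at z)"
      using has_derivative_compose[OF angle_has_derivative[OF x B(3)[OF z]] V(1)[unfolded has_field_derivative_def]] .
    from has_derivative_add[OF bounded_linear_imp_has_derivative[OF L]
        has_derivative_mult[OF SS_has_derivative[OF x zeta_slit_nonzero[OF B(3)[OF z]]] this]]
    have "(f has_derivative (\<lambda>v. L v + (SS R x z * (V' ?\<psi> * ((p x z * q x v - q x z * p x v) / (SS R x z)\<^sup>2))
        + (p x z * p x v + q x z * q x v) / SS R x z * V ?\<psi>))) (at z)"
      by (rule has_derivative_transform_within_open[OF _ B(1) z]) (simp add: f)
    from partial_eq[OF this] have "partial i f z = L (axis i 1)
        + (SS R x z * (V' ?\<psi> * ((p x z * ?n - q x z * ?b) / (SS R x z)\<^sup>2)) + (p x z * ?b + q x z * ?n) / SS R x z * V ?\<psi>)"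
      by (simp add: inner_axis)
    also have "\<dots> = ?g z"
      unfolding angle_cis[OF x B(3)[OF z]] using S[OF z] by (simp add: field_simps power2_eq_square)
    finally show ?thesis .
  qed
  then have "partial m (partial i f) y = partial m ?g y"
    using B by (intro partial_cong[of B]) auto
  also have "\<dots> = (cos (angle \<gamma> x y) * ?n - sin (angle \<gamma> x y) * ?b) * (V (angle \<gamma> x y) + V'' (angle \<gamma> x y))
      * ((p x y * covn R x $ m - q x y * covb R x $ m) / (SS R x y)\<^sup>2)"
  proof -
    let ?h = "\<lambda>s. L (axis i 1) + ((cos s * ?b + sin s * ?n) * V s + (cos s * ?n - sin s * ?b) * V' s)"
    have "(?h has_real_derivative (cos s * ?n - sin s * ?b) * (V s + V'' s)) (at s)" for s
      by (rule derivative_eq_intros refl V)+ (simp add: algebra_simps)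
    from has_derivative_compose[OF angle_has_derivative[OF x B(3)[OF B(2)]] this[unfolded has_field_derivative_def]]
    have "(?g has_derivative (\<lambda>v. (cos (angle \<gamma> x y) * ?n - sin (angle \<gamma> x y) * ?b) * (V (angle \<gamma> x y) + V'' (angle \<gamma> x y))
      * ((p x y * q x v - q x y * p x v) / (SS R x y)\<^sup>2))) (at y)" .
    from partial_eq[OF this] show ?thesis by (simp add: inner_axis)
  qed
  finally show ?thesis by (simp add: mult_ac)
qed

text \<open>The vector \<open>shift\<close> expands in the frame \<open>l\<close>, \<open>m\<close> with exactly the coefficients with which it enters
  \<open>\<partial>F/\<partial>x\<^sup>n\<close> and \<open>\<partial>\<theta>/\<partial>x\<^sup>n\<close>; it therefore splits off from \<open>N\<close> as a linear term, and what remains is governed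
  by \<open>connection_profile\<close>.\<close>

lemma N_coeff_contraction:
  assumes \<theta>: "angle_function U R W \<theta>" and y: "(x, y) \<in> W"
  shows "(\<Sum>k\<in>UNIV. y_low R x y $ k * partial m (partial i (N_coeff R \<theta> kf k n x)) y) = 0"
proof -
  have x: "x \<in> U" and y0: "y \<noteq> 0" using \<theta> y by (auto simp: angle_function_def punctured_TM_def)
  obtain \<gamma> B where B: "open B" "y \<in> B" "B \<subseteq> fib W x"
    "\<And>y. y \<in> B \<Longrightarrow> zeta x y \<in> slit \<gamma>"
    and dn: "\<And>y n. y \<in> B \<Longrightarrow> partial n (\<lambda>u. \<theta> u y) x =
       dc x n * arc_length_deriv (c x) (angle \<gamma> x y) + (m_low R x y \<bullet> shift x n y) / FF R x y"
    using theta_base_derivative[OF \<theta> y] by metis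
  define h where "h s = dc x n * arc_length_deriv (c x) s - kf x $ n" for s
  interpret P: connection_profile "c x" "dc x n" h
  proof
    show "\<bar>c x\<bar> < 1" using c_abs[OF x] .
    show "(h has_real_derivative - (1/2) * dc x n * cos s * arc_rate (c x) s ^ 3) (at s)" for s
      unfolding h_def by (rule derivative_eq_intros DERIV_arc_length_deriv c_abs x refl)+ simp
  qed
  obtain V1'' V2'' where V'': "\<And>s. (P.V1' has_real_derivative V1'' s) (at s)" "\<And>s. (P.V2' has_real_derivative V2'' s) (at s)"
    using P.second_derivatives by blast
  have N: "N_coeff R \<theta> kf k n x z = - shift x n z $ k
      + SS R x z * (P.V1 (angle \<gamma> x z) * e1 x $ k + P.V2 (angle \<gamma> x z) * e2 x $ k)" if z: "z \<in> B" for z k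
  proof -
    have z0: "z \<noteq> 0" using zeta_slit_nonzero[OF B(4)[OF z]] .
    have S: "SS R x z > 0" "FF R x z > 0" using x z0 by (auto intro: SS_pos FF_pos)
    define r where "r = sqrt (SS R x z / FF R x z)"
    have r2: "r\<^sup>2 = SS R x z / FF R x z" using S by (simp add: r_def)
    note pq = angle_cis[OF x B(4)[OF z]]
    let ?C = "cos (angle \<gamma> x z)" and ?s = "sin (angle \<gamma> x z)"
    have sh: "shift x n z $ k = (F_low x z \<bullet> shift x n z) * l_up R x z $ k + (m_low R x z \<bullet> shift x n z) * m_vec x z $ k"
      using arg_cong[OF dual_frame_expand[OF Finsler_frame_dual[OF x z0], of "shift x n z"], of "\<lambda>v. v $ k"] by simp
    have "z $ k = SS R x z * (?C * e1 x $ k + ?s * e2 x $ k)"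
      using arg_cong[OF frame_expand[OF x, of z], of "\<lambda>v. v $ k"] pq by (simp add: algebra_simps)
    then have l: "l_up R x z $ k = r\<^sup>2 * (?C * e1 x $ k + ?s * e2 x $ k)"
      by (simp add: l_up_def r2)
    have m: "FF R x z * m_vec x z $ k = SS R x z * r * (- ?s * e1 x $ k + (c x + ?C) * e2 x $ k)"
      unfolding m_vec_def r_def[symmetric] using S pq by (simp add: algebra_simps)
    have "N_coeff R \<theta> kf k n x z = - l_up R x z $ k * (F_low x z \<bullet> shift x n z + dc x n * p x z)
        - FF R x z * m_vec x z $ k * (h (angle \<gamma> x z) + (m_low R x z \<bullet> shift x n z) / FF R x z)"
      unfolding N_coeff_def FF_base_derivative(2)[OF x z0] dn[OF z] m_up_eq[OF x z0] h_def by simp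
    also have "\<dots> = - shift x n z $ k - l_up R x z $ k * (dc x n * p x z) - FF R x z * m_vec x z $ k * h (angle \<gamma> x z)"
      unfolding sh using S by (simp add: field_simps)
    also have "\<dots> = - shift x n z $ k
      + SS R x z * (P.V1 (angle \<gamma> x z) * e1 x $ k + P.V2 (angle \<gamma> x z) * e2 x $ k)"
      unfolding m l pq(1) P.V1_def P.V2_def arc_rate_angle[OF x B(4)[OF z]] r_def[symmetric]
      by (simp add: power2_eq_square algebra_simps)
    finally show ?thesis .
  qed
  define K where "K = (cos (angle \<gamma> x y) * covn R x $ i - sin (angle \<gamma> x y) * covb R x $ i)
       * ((p x y * covn R x $ m - q x y * covb R x $ m) / (SS R x y)\<^sup>2)"
  define X Y where "X = P.V1 (angle \<gamma> x y) + V1'' (angle \<gamma> x y)" and "Y = P.V2 (angle \<gamma> x y) + V2'' (angle \<gamma> x y)"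
  have H: "partial m (partial i (N_coeff R \<theta> kf k n x)) y = K * (X * e1 x $ k + Y * e2 x $ k)" for k
  proof -
    have L: "bounded_linear (\<lambda>z. - shift x n z $ k)"
      unfolding linear_conv_bounded_linear[symmetric]
      by (rule linearI) (simp_all add: shift_def inner_simps algebra_simps)
    have d1: "((\<lambda>s. P.V1 s * e1 x $ k + P.V2 s * e2 x $ k) has_real_derivative P.V1' s * e1 x $ k + P.V2' s * e2 x $ k) (at s)" for s
      by (intro derivative_intros DERIV_cmult_right P.DERIV_V1 P.DERIV_V2)
    have d2: "((\<lambda>s. P.V1' s * e1 x $ k + P.V2' s * e2 x $ k) has_real_derivative V1'' s * e1 x $ k + V2'' s * e2 x $ k) (at s)" for s
      by (intro derivative_intros DERIV_cmult_right V'')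
    note hessian_polar[OF x B(1,2,4) L d1 d2 N[where k = k], of m i, folded K_def]
    then show ?thesis by (simp add: X_def Y_def algebra_simps)
  qed
  have "F_low x y \<bullet> e1 x = cos (angle \<gamma> x y) + c x" "F_low x y \<bullet> e2 x = sin (angle \<gamma> x y)"
    using SS_pos[OF x y0] angle_cis[OF x B(4)[OF B(2)]] frame_dual[OF x] by (simp_all add: F_low_inner)
  then have "(F_low x y \<bullet> e1 x) * X + (F_low x y \<bullet> e2 x) * Y = 0"
    using P.profile_contraction[OF V''] by (simp add: X_def Y_def)
  moreover have "(\<Sum>k\<in>UNIV. y_low R x y $ k * partial m (partial i (N_coeff R \<theta> kf k n x)) y)
      = FF R x y * K * ((F_low x y \<bullet> e1 x) * X + (F_low x y \<bullet> e2 x) * Y)"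
    by (simp add: H y_low_eq[OF x y0] sum_2 inner_2 algebra_simps)
  ultimately show ?thesis by simp
qed

lemma N_coeff_inner:
  assumes "x \<in> U" "y \<noteq> 0"
  shows "(\<Sum>k\<in>UNIV. N_coeff R \<theta> kf k n x y * z $ k) =
     - partial n (\<lambda>u. FF R u y) x * (z \<bullet> l_up R x y)
     - FF R x y * (partial n (\<lambda>u. \<theta> u y) x - kf x $ n) * (z \<bullet> m_vec x y)"
  by (simp add: N_coeff_def m_up_eq[OF assms] sum_2 inner_2 algebra_simps)

lemma partial_theta:
  assumes "angle_function U R W \<theta>" "(x, y) \<in> W"
  shows "partial k (\<theta> x) y = ((1 / FF R x y) *\<^sub>R m_low R x y) $ k"
  using partial_eq[OF angle_function_has_derivative[OF assms]] by (simp add: inner_axis)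

lemma d_op_theta:
  assumes \<theta>: "angle_function U R W \<theta>" and y: "(x, y) \<in> W"
  shows "d_op (N_coeff R \<theta> kf) n \<theta> x y = kf x $ n"
proof -
  have x: "x \<in> U" and y0: "y \<noteq> 0" using \<theta> y by (auto simp: angle_function_def punctured_TM_def)
  show ?thesis
    using FF_pos[OF x y0] Finsler_frame_dual[OF x y0]
    by (simp add: d_op_def partial_theta[OF \<theta> y] N_coeff_inner[OF x y0] del: vector_scaleR_component)
qed

lemma N_coeff_angle_preserving:
  assumes \<theta>: "angle_function U R W \<theta>"
  shows "angle_preserving R W \<theta> kf (N_coeff R \<theta> kf)"
  unfolding angle_preserving_def
proof (intro conjI allI impI)
  fix x y n assume y: "(x, y) \<in> W"
  have x: "x \<in> U" and y0: "y \<noteq> 0" using \<theta> y by (auto simp: angle_function_def punctured_TM_def)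
  have "partial k (FF R x) y = F_low x y $ k" for k
    using partial_eq[OF FF_has_derivative[OF x y0]] by (simp add: inner_axis)
  then show "d_op (N_coeff R \<theta> kf) n (FF R) x y = 0"
    using Finsler_frame_dual[OF x y0] by (simp add: d_op_def N_coeff_inner[OF x y0])
  show "d_op (N_coeff R \<theta> kf) n \<theta> x y = kf x $ n" using \<theta> y by (rule d_op_theta)
  show "(\<Sum>k\<in>UNIV. y_low R x y $ k * partial m (partial i (N_coeff R \<theta> kf k n x)) y) = 0" for m i
    using \<theta> y by (rule N_coeff_contraction)
next
  fix x y1 y2 n assume y: "(x, y1) \<in> W" "(x, y2) \<in> W"
  have b: "((\<lambda>u. \<theta> u z) has_derivative frechet_derivative (\<lambda>u. \<theta> u z) (at x)) (at x)" if "(x, z) \<in> W" for z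
    using theta_base_derivative[OF \<theta> that] by (metis frechet_derivative_works)
  have "partial n (\<lambda>u. \<theta> u y2 - \<theta> u y1) x = partial n (\<lambda>u. \<theta> u y2) x - partial n (\<lambda>u. \<theta> u y1) x"
    using partial_eq[OF has_derivative_diff[OF b[OF y(2)] b[OF y(1)]]] partial_eq[OF b[OF y(1)]] partial_eq[OF b[OF y(2)]] by simp
  moreover have "partial k (\<lambda>z. \<theta> x y2 - \<theta> x z) y1 = - partial k (\<theta> x) y1" for k
    using partial_eq[OF has_derivative_diff[OF has_derivative_const angle_function_has_derivative[OF \<theta> y(1)]]]
      partial_eq[OF angle_function_has_derivative[OF \<theta> y(1)]] by simp
  moreover have "partial k (\<lambda>z. \<theta> x z - \<theta> x y1) y2 = partial k (\<theta> x) y2" for k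
    using partial_eq[OF has_derivative_diff[OF angle_function_has_derivative[OF \<theta> y(2)] has_derivative_const]]
      partial_eq[OF angle_function_has_derivative[OF \<theta> y(2)]] by simp
  ultimately have "d_op2 (N_coeff R \<theta> kf) n (\<lambda>u z1 z2. \<theta> u z2 - \<theta> u z1) x y1 y2
      = d_op (N_coeff R \<theta> kf) n \<theta> x y2 - d_op (N_coeff R \<theta> kf) n \<theta> x y1"
    by (simp add: d_op2_def d_op_def sum_negf)
  then show "d_op2 (N_coeff R \<theta> kf) n (\<lambda>u z1 z2. \<theta> u z2 - \<theta> u z1) x y1 y2 = 0"
    by (simp add: d_op_theta[OF \<theta>] y)
qed

section \<open>Existence of angle functions\<close>

definition slit_domain :: "real \<Rightarrow> ((real^2) \<times> (real^2)) set" where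
  "slit_domain \<gamma> = {(x, y). x \<in> U \<and> zeta x y \<in> slit \<gamma>}"

lemma zeta_linear: "zeta x (a *\<^sub>R y + b *\<^sub>R z) = a *\<^sub>R zeta x y + b *\<^sub>R zeta x z"
  by (simp add: zeta_def complex_eq_iff inner_simps)

text \<open>A slit plane is starlike about every point of the ray opposite to the slit.\<close>

lemma connected_slit:
  assumes x: "x \<in> U"
  shows "connected {y. zeta x y \<in> slit \<gamma>}"
proof (rule starlike_imp_connected)
  let ?a = "cos \<gamma> *\<^sub>R e1 x + sin \<gamma> *\<^sub>R e2 x"
  have a: "zeta x ?a = cis \<gamma>"
    using frame_dual[OF x] by (simp add: zeta_def complex_eq_iff inner_simps)
  show "starlike {y. zeta x y \<in> slit \<gamma>}"
    unfolding starlike_def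
  proof (intro bexI[of _ ?a] ballI subsetI)
    show "?a \<in> {y. zeta x y \<in> slit \<gamma>}" by (simp add: a slit_def cis_mult)
    fix y z assume y: "y \<in> {y. zeta x y \<in> slit \<gamma>}" and "z \<in> closed_segment ?a y"
    then obtain u where u: "0 \<le> u" "u \<le> 1" "z = (1 - u) *\<^sub>R ?a + u *\<^sub>R y"
      by (auto simp: in_segment)
    define w where "w = cis (-\<gamma>) * zeta x y"
    have w: "Re w > 0 \<or> Im w \<noteq> 0" using y by (auto simp: slit_def w_def complex_nonpos_Reals_iff)
    have "cis (-\<gamma>) * zeta x z = (1 - u) *\<^sub>R (cis (-\<gamma>) * cis \<gamma>) + u *\<^sub>R w"
      unfolding u(3) zeta_linear[of x "1 - u" ?a u y] a by (simp add: w_def algebra_simps)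
    also have "\<dots> = (1 - u) *\<^sub>R 1 + u *\<^sub>R w" by (simp add: cis_mult)
    finally have *: "cis (-\<gamma>) * zeta x z = (1 - u) *\<^sub>R 1 + u *\<^sub>R w" .
    have "0 < (1 - u) + u * Re w \<or> u * Im w \<noteq> 0"
    proof (cases "u = 0 \<or> Im w = 0")
      case True
      then show ?thesis using w u by (cases "u = 1") (auto intro: add_pos_nonneg)
    qed auto
    then show "z \<in> {y. zeta x y \<in> slit \<gamma>}"
      unfolding slit_def mem_Collect_eq * by (auto simp: complex_nonpos_Reals_iff)
  qed
qed

lemma angle_function_slit:
  assumes \<gamma>: "-pi < \<gamma>" "\<gamma> < pi"
  shows "angle_function U R (slit_domain \<gamma>) (\<lambda>x y. arc_length (c x) (angle \<gamma> x y))"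
  unfolding angle_function_def
proof (intro conjI allI ballI impI)
  have "slit_domain \<gamma> = (U \<times> UNIV) \<inter> (\<lambda>(x, y). zeta x y) -` slit \<gamma>"
    by (auto simp: slit_domain_def)
  then show "open (slit_domain \<gamma>)"
    by (auto intro!: continuous_open_preimage continuous_on_zeta open_slit open_Times open_U)
  show "slit_domain \<gamma> \<subseteq> punctured_TM U"
    using zeta_slit_nonzero by (auto simp: slit_domain_def punctured_TM_def)
next
  fix x assume x: "x \<in> U"
  show "connected (fib (slit_domain \<gamma>) x)"
    using connected_slit[OF x, of \<gamma>] x by (simp add: fib_def slit_domain_def)
  have z: "zeta x (b_up R x) = of_real (c x)"
    using frame_dual[OF x] by (simp add: zeta_def b_up_eq[OF x] complex_eq_iff)
  have A: "Arg (cis (-\<gamma>) * of_real (c x)) = -\<gamma>"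
    using c_bounds[OF x] \<gamma> by (simp add: Arg_cis)
  then have nz: "cis (-\<gamma>) * complex_of_real (c x) \<noteq> 0"
    using c_bounds[OF x] by simp
  have "cis (-\<gamma>) * complex_of_real (c x) \<notin> \<real>\<^sub>\<le>\<^sub>0"
  proof
    assume "cis (-\<gamma>) * complex_of_real (c x) \<in> \<real>\<^sub>\<le>\<^sub>0"
    then have "Arg (cis (-\<gamma>) * complex_of_real (c x)) = pi"
      using nz by (auto simp: Arg_eq_pi complex_nonpos_Reals_iff complex_eq_iff less_le)
    then show False using A \<gamma> by simp
  qed
  then show "b_up R x \<in> fib (slit_domain \<gamma>) x"
    using x by (simp add: fib_def slit_domain_def z slit_def)
  show "arc_length (c x) (angle \<gamma> x (b_up R x)) = 0"
    using A nz by (simp add: angle_def z polar_angle_def arc_length_def flip: Arg_eq_Im_Ln)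
next
  fix x y and t :: real assume "(x, y) \<in> slit_domain \<gamma>" and t: "t > 0"
  then have x: "x \<in> U" and y: "zeta x y \<in> slit \<gamma>" by (auto simp: slit_domain_def)
  have z: "cis (-\<gamma>) * zeta x (t *\<^sub>R y) = of_real t * (cis (-\<gamma>) * zeta x y)"
    by (simp add: zeta_def complex_eq_iff algebra_simps)
  show "(x, t *\<^sub>R y) \<in> slit_domain \<gamma>"
  proof -
    have "of_real t * w \<in> \<real>\<^sub>\<le>\<^sub>0 \<Longrightarrow> w \<in> \<real>\<^sub>\<le>\<^sub>0" for w :: complex
      using t by (auto simp: complex_nonpos_Reals_iff mult_le_0_iff)
    then show ?thesis
      using x y unfolding slit_domain_def slit_def by (auto simp only: z mem_Collect_eq case_prod_conv)
  qed
  have "cis (-\<gamma>) * zeta x y \<noteq> 0" using y by (auto simp: slit_def)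
  then have "angle \<gamma> x (t *\<^sub>R y) = angle \<gamma> x y"
    unfolding angle_def polar_angle_def z using t by (simp add: Ln_times_of_real)
  then show "arc_length (c x) (angle \<gamma> x (t *\<^sub>R y)) = arc_length (c x) (angle \<gamma> x y)" by simp
next
  fix x y assume "(x, y) \<in> slit_domain \<gamma>"
  then have x: "x \<in> U" and y: "zeta x y \<in> slit \<gamma>" by (auto simp: slit_domain_def)
  note d = local_theta_has_derivative[OF x y]
  show "(\<lambda>y. arc_length (c x) (angle \<gamma> x y)) differentiable (at y)"
    using d by (auto simp: differentiable_def)
  show "FF R x y * partial i (\<lambda>y. arc_length (c x) (angle \<gamma> x y)) y = m_low R x y $ i" for i
    using FF_pos[OF x zeta_slit_nonzero[OF y]] by (simp add: partial_eq[OF d] inner_axis)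
qed

lemma mem_chart_dom:
  "(x, y) \<in> chart_dom U R B_pos \<longleftrightarrow> x \<in> U \<and> p x y > 0"
  "(x, y) \<in> chart_dom U R N_pos \<longleftrightarrow> x \<in> U \<and> q x y > 0"
  "(x, y) \<in> chart_dom U R N_neg \<longleftrightarrow> x \<in> U \<and> q x y < 0"
  "(x, y) \<in> chart_dom U R B_neg \<longleftrightarrow> x \<in> U \<and> p x y < 0"
  using c_bounds[of x]
  by (auto simp: b_form_def b_low_def n_form_def zero_less_mult_iff mult_less_0_iff)

lemma ex_chart: "(\<exists>q. P q) \<longleftrightarrow> P B_pos \<or> P N_pos \<or> P N_neg \<or> P B_neg"
  by (metis chart.exhaust)

lemma charts_cover: "(\<Union>q\<in>UNIV. chart_dom U R q) = punctured_TM U"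
proof (rule set_eqI, clarify)
  fix x y
  have "(x, y) \<in> (\<Union>q\<in>UNIV. chart_dom U R q) \<longleftrightarrow> x \<in> U \<and> (p x y \<noteq> 0 \<or> q x y \<noteq> 0)"
    by (auto simp: UN_iff ex_chart mem_chart_dom simp del: chart_dom.simps)
  then show "(x, y) \<in> (\<Union>q\<in>UNIV. chart_dom U R q) \<longleftrightarrow> (x, y) \<in> punctured_TM U"
    using coframe_eq_0_imp by (auto simp: punctured_TM_def)
qed

text \<open>Without \<open>{b < 0}\<close> the cut is the negative \<open>p\<close>-axis; without \<open>{n > 0}\<close> or \<open>{n < 0}\<close> it is the
  positive or negative \<open>q\<close>-axis.\<close>

lemma three_charts:
  assumes "q' \<noteq> B_pos"
  obtains \<gamma> where "-pi < \<gamma>" "\<gamma> < pi" "(\<Union>p\<in>- {q'}. chart_dom U R p) = slit_domain \<gamma>"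
proof -
  have sl: "(x, y) \<in> slit_domain \<gamma> \<longleftrightarrow> x \<in> U \<and>
      (cos \<gamma> * p x y + sin \<gamma> * q x y > 0 \<or> cos \<gamma> * q x y - sin \<gamma> * p x y \<noteq> 0)" for x y \<gamma>
    by (auto simp: slit_domain_def slit_def complex_nonpos_Reals_iff zeta_def algebra_simps)
  have ch: "(x, y) \<in> (\<Union>p\<in>- {q'}. chart_dom U R p) \<longleftrightarrow> x \<in> U \<and>
     (p x y > 0 \<or> (q' \<noteq> N_pos \<and> q x y > 0) \<or> (q' \<noteq> N_neg \<and> q x y < 0) \<or> (q' \<noteq> B_neg \<and> p x y < 0))" for x y
    using assms by (auto simp: UN_iff Bex_def ex_chart mem_chart_dom simp del: chart_dom.simps)
  consider "q' = B_neg" | "q' = N_pos" | "q' = N_neg" using assms by (cases q') auto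
  then show ?thesis
  proof cases
    case 1
    have "(\<Union>p\<in>- {q'}. chart_dom U R p) = slit_domain 0"
      unfolding set_eq_iff split_paired_All ch sl using 1 by auto
    then show ?thesis by (intro that[of 0]) auto
  next
    case 2
    have "(\<Union>p\<in>- {q'}. chart_dom U R p) = slit_domain (- (pi/2))"
      unfolding set_eq_iff split_paired_All ch sl using 2 by auto
    then show ?thesis
      using pi_gt_zero by (intro that[of "- (pi/2)"]) (linarith | simp)+
  next
    case 3
    have "(\<Union>p\<in>- {q'}. chart_dom U R p) = slit_domain (pi/2)"
      unfolding set_eq_iff split_paired_All ch sl using 3 by auto
    then show ?thesis by (intro that[of "pi/2"]) auto
  qed
qed

end

theorem mainTheorem10:
  fixes U :: "(real^2) set" and R :: randers and kf :: "real^2 \<Rightarrow> real^2"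
  assumes "randers_on U R" and "smooth_on U kf"
  shows
    "(\<forall>x\<in>U. \<forall>n.
        (\<forall>y. y \<noteq> 0 \<longrightarrow> (\<lambda>u. FF R u y) differentiable (at x)) \<and>
        smooth_on (- {0}) (\<lambda>y. partial n (\<lambda>u. FF R u y) x)) \<and>
     (\<forall>W \<theta>. angle_function U R W \<theta> \<longrightarrow>
        (\<forall>x\<in>U. \<forall>n.
           (\<forall>y\<in>fib W x. (\<lambda>u. \<theta> u y) differentiable (at x)) \<and>
           smooth_on (fib W x) (\<lambda>y. partial n (\<lambda>u. \<theta> u y) x)) \<and>
        angle_preserving R W \<theta> kf (N_coeff R \<theta> kf) \<and>
        (\<forall>x\<in>U. \<forall>k n.
           smooth_on (fib W x) (N_coeff R \<theta> kf k n x) \<and>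
           (\<forall>m. smooth_on (fib W x) (D_coeff (N_coeff R \<theta> kf) k n m x)))) \<and>
     (\<Union>q\<in>UNIV. chart_dom U R q) = punctured_TM U \<and>
     (\<forall>q. q \<noteq> B_pos \<longrightarrow>
        (\<exists>\<theta>. angle_function U R (\<Union>p\<in>- {q}. chart_dom U R p) \<theta>))"
proof -
  interpret randers_surface U R by unfold_locales (rule assms(1))
  show ?thesis
  proof (intro conjI ballI allI impI)
    fix x n assume x: "x \<in> U"
    show "(\<lambda>u. FF R u y) differentiable (at x)" if "y \<noteq> 0" for y
      using x that by (rule FF_base_derivative(1))
    show "smooth_on (- {0}) (\<lambda>y. partial n (\<lambda>u. FF R u y) x)"
      using x by (rule FF_base_derivative_smooth)
  next
    fix W \<theta> assume \<theta>: "angle_function U R W \<theta>"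
    show "angle_preserving R W \<theta> kf (N_coeff R \<theta> kf)"
      using \<theta> by (rule N_coeff_angle_preserving)
    fix x n assume x: "x \<in> U"
    show "(\<lambda>u. \<theta> u y) differentiable (at x)" if "y \<in> fib W x" for y
      using theta_base_derivative[OF \<theta>, of x y] that by (metis fib_def mem_Collect_eq)
    show "smooth_on (fib W x) (\<lambda>y. partial n (\<lambda>u. \<theta> u y) x)"
      using \<theta> x by (rule theta_base_derivative_smooth)
    fix k
    show N: "smooth_on (fib W x) (N_coeff R \<theta> kf k n x)"
      using \<theta> x by (rule N_coeff_smooth)
    show "smooth_on (fib W x) (D_coeff (N_coeff R \<theta> kf) k n m x)" for m
      unfolding D_coeff_def[abs_def]
      by (intro smooth_on_minus smooth_on_partial N open_fib[OF \<theta>])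
  next
    show "(\<Union>q\<in>UNIV. chart_dom U R q) = punctured_TM U" by (rule charts_cover)
    show "\<exists>\<theta>. angle_function U R (\<Union>p\<in>- {q'}. chart_dom U R p) \<theta>" if "q' \<noteq> B_pos" for q'
      using three_charts[OF that] angle_function_slit by metis
  qed
qed

end
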